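(* Let $F_k=F(X)$ be the free group over $X$, where $|X|=k$, and let $n\le k$. Then $$\mathcal P_{k,n}=\{w_1\#\cdots\#w_n\mid \{w_1,\dots,w_n\}\text{ is a primitive set in }F_k\}\subseteq (X\cup X^{-1}\cup\{\#\})^*$$ (where $w_1,\dots,w_n$ are reduced words over $X\cup X^{-1}$) is a context-sensitive language. In particular, the set $P_k=\mathcal P_{k,1}$ of primitive elements of $F_k$ is context-sensitive.
   Context: A primitive set in a free group $F$ is a set of elements that can be extended to a free basis of $F$; a primitive element is an element that belongs to some free basis of $F$. The symbol $\#$ is not in $X\cup X^{-1}$. Context-sensitive languages are those recognised by (nondeterministic) linearly bounded Turing machines. *)

theory Defs
  imports "HOL-Algebra.Group"
begin

section \<open>Free groups, bases and primitive sets\<close>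

text \<open>
  The letter \<open>(x, True)\<close> stands for the generator \<open>x\<close> and
  \<open>(x, False)\<close> for its formal inverse.
\<close>

type_synonym 'a letter = "'a \<times> bool"
type_synonym 'a word = "'a letter list"

definition inv_letter :: "'a letter \<Rightarrow> 'a letter" where
  "inv_letter a = (fst a, \<not> snd a)"

definition reduced :: "'a word \<Rightarrow> bool" where
  "reduced = successively (\<lambda>a b. b \<noteq> inv_letter a)"

fun push :: "'a letter \<Rightarrow> 'a word \<Rightarrow> 'a word" where
  "push a [] = [a]"
| "push a (b # w) = (if b = inv_letter a then w else a # b # w)"

definition free_reduce :: "'a word \<Rightarrow> 'a word" where
  "free_reduce w = foldr push w []"

definition free_group :: "'a set \<Rightarrow> 'a word monoid" where
  "free_group X =
    \<lparr>carrier = {w \<in> lists (X \<times> UNIV). reduced w},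
     monoid.mult = (\<lambda>u v. free_reduce (u @ v)),
     one = []\<rparr>"

definition word_eval :: "('g, 'm) monoid_scheme \<Rightarrow> 'g word \<Rightarrow> 'g" where
  "word_eval G w =
    foldr (\<lambda>(x, b) y. (if b then x else inv\<^bsub>G\<^esub> x) \<otimes>\<^bsub>G\<^esub> y) w \<one>\<^bsub>G\<^esub>"

text \<open>
  \<open>G\<close> is free on its subset \<open>B\<close> if the homomorphism from the free group on the
  set \<open>B\<close> to \<open>G\<close> extending the inclusion of \<open>B\<close> is an isomorphism.
\<close>

definition free_basis :: "('g, 'm) monoid_scheme \<Rightarrow> 'g set \<Rightarrow> bool" where
  "free_basis G B \<longleftrightarrow> B \<subseteq> carrier G \<and> word_eval G \<in> iso (free_group B) G"

definition primitive_set :: "('g, 'm) monoid_scheme \<Rightarrow> 'g set \<Rightarrow> bool" where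
  "primitive_set G S \<longleftrightarrow> (\<exists>B. free_basis G B \<and> S \<subseteq> B)"

definition primitive_element :: "('g, 'm) monoid_scheme \<Rightarrow> 'g \<Rightarrow> bool" where
  "primitive_element G g \<longleftrightarrow> (\<exists>B. free_basis G B \<and> g \<in> B)"

text \<open>The structure \<open>free_group X\<close> is indeed a group.\<close>

lemma inv_letter_inv [simp]: "inv_letter (inv_letter a) = a"
  by (simp add: inv_letter_def)

lemma reduced_Nil [simp]: "reduced []"
  by (simp add: reduced_def)

lemma reduced_Cons:
  "reduced (a # w) \<longleftrightarrow> reduced w \<and> (w = [] \<or> hd w \<noteq> inv_letter a)"
  by (cases w) (auto simp: reduced_def)

lemma reduced_push: "reduced w \<Longrightarrow> reduced (push a w)"
  by (cases w) (auto simp: reduced_Cons)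

lemma push_push_inv: "reduced w \<Longrightarrow> push a (push (inv_letter a) w) = w"
  by (cases w rule: list.exhaust; cases "tl w") (auto simp: reduced_Cons)

lemma foldr_push_reduced: "reduced v \<Longrightarrow> reduced (foldr push u v)"
  by (induction u) (auto simp: reduced_push)

lemma free_reduce_id: "reduced w \<Longrightarrow> free_reduce w = w"
  unfolding free_reduce_def
proof (induction w)
  case (Cons a w)
  then show ?case by (cases w) (auto simp: reduced_Cons)
qed simp

lemma foldr_push_push:
  assumes "reduced v"
  shows "foldr push (push a u) v = push a (foldr push u v)"
proof (cases u)
  case (Cons b u')
  then show ?thesis
    using push_push_inv[OF foldr_push_reduced[OF assms], of a] by auto
qed simp

lemma foldr_push_foldr:
  "reduced v \<Longrightarrow> foldr push (foldr push u t) v = foldr push u (foldr push t v)"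
  by (induction u) (auto simp: foldr_push_push)

lemma free_reduce_append:
  "reduced v \<Longrightarrow> free_reduce (u @ v) = foldr push u v"
  using free_reduce_id[of v] by (simp add: free_reduce_def)

lemma push_in_lists: "a \<in> A \<Longrightarrow> w \<in> lists A \<Longrightarrow> push a w \<in> lists A"
  by (cases w) auto

lemma foldr_push_in_lists: "u \<in> lists A \<Longrightarrow> v \<in> lists A \<Longrightarrow> foldr push u v \<in> lists A"
  by (induction u) (simp_all add: push_in_lists del: in_lists_conv_set)

lemma foldr_push_left_inverse:
  "reduced v \<Longrightarrow> foldr push (rev (map inv_letter w)) (foldr push w v) = v"
proof (induction w arbitrary: v)
  case (Cons a w)
  then show ?case
    using push_push_inv[OF foldr_push_reduced[OF Cons.prems], of "inv_letter a"] by simp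
qed simp

lemma group_free_group: "group (free_group X)"
proof (rule groupI)
  let ?F = "free_group X"
  have mult: "u \<otimes>\<^bsub>?F\<^esub> v = foldr push u v" if "v \<in> carrier ?F" for u v
    using that by (simp add: free_group_def free_reduce_append)
  have closed: "foldr push u v \<in> carrier ?F"
    if "u \<in> lists (X \<times> UNIV)" "v \<in> carrier ?F" for u v
    using that by (simp add: free_group_def foldr_push_reduced foldr_push_in_lists
        del: in_lists_conv_set)
  have red: "reduced v" if "v \<in> carrier ?F" for v
    using that by (simp add: free_group_def)
  have lists: "v \<in> lists (X \<times> UNIV)" if "v \<in> carrier ?F" for v
    using that by (simp add: free_group_def del: in_lists_conv_set)
  have one: "\<one>\<^bsub>?F\<^esub> = []" "[] \<in> carrier ?F"
    by (simp_all add: free_group_def)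
  show "\<one>\<^bsub>?F\<^esub> \<in> carrier ?F" by (simp add: one)
  show "u \<otimes>\<^bsub>?F\<^esub> v \<in> carrier ?F" if "u \<in> carrier ?F" "v \<in> carrier ?F" for u v
    using that by (simp add: mult closed lists del: in_lists_conv_set)
  show "u \<otimes>\<^bsub>?F\<^esub> v \<otimes>\<^bsub>?F\<^esub> w = u \<otimes>\<^bsub>?F\<^esub> (v \<otimes>\<^bsub>?F\<^esub> w)"
    if "u \<in> carrier ?F" "v \<in> carrier ?F" "w \<in> carrier ?F" for u v w
    using that by (simp add: mult closed lists red foldr_push_foldr del: in_lists_conv_set)
  show "\<one>\<^bsub>?F\<^esub> \<otimes>\<^bsub>?F\<^esub> v = v" if "v \<in> carrier ?F" for v
    using that by (simp add: mult one)
  show "\<exists>u \<in> carrier ?F. u \<otimes>\<^bsub>?F\<^esub> v = \<one>\<^bsub>?F\<^esub>" if v: "v \<in> carrier ?F" for v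
  proof
    let ?u = "foldr push (rev (map inv_letter v)) []"
    have "rev (map inv_letter v) \<in> lists (X \<times> UNIV)"
      using lists[OF v] by (induction v) (auto simp: inv_letter_def)
    then show "?u \<in> carrier ?F" by (intro closed one)
    have "v = foldr push v []"
      using free_reduce_id[OF red[OF v]] by (simp add: free_reduce_def)
    then have "foldr push (rev (map inv_letter v)) v = []"
      using foldr_push_left_inverse[of "[]" v] by simp
    then show "?u \<otimes>\<^bsub>?F\<^esub> v = \<one>\<^bsub>?F\<^esub>"
      using foldr_push_foldr[OF red[OF v], of "rev (map inv_letter v)" "[]"]
      by (simp add: mult v one)
  qed
qed


section \<open>Linearly bounded automata and context-sensitive languages\<close>

text \<open>
  The input is written between two end markers, which are never overwritten or
  crossed, so the machine works in the cells occupied by its input. States and the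
  auxiliary tape symbols are numbered; only finitely many of each are used.
\<close>

datatype 's tape_symbol = LEnd | REnd | Input 's | Aux nat

datatype direction = MoveL | Stay | MoveR

record 's lba =
  states :: "nat set"
  aux_symbols :: "nat set"
  initial :: nat
  accepting :: "nat set"
  delta :: "(nat \<times> 's tape_symbol \<times> nat \<times> 's tape_symbol \<times> direction) set"

definition work_alphabet :: "'s set \<Rightarrow> 's lba \<Rightarrow> 's tape_symbol set" where
  "work_alphabet \<Sigma> M = Input ` \<Sigma> \<union> Aux ` aux_symbols M"

definition is_lba :: "'s set \<Rightarrow> 's lba \<Rightarrow> bool" where
  "is_lba \<Sigma> M \<longleftrightarrow>
    finite \<Sigma> \<and> finite (states M) \<and> finite (aux_symbols M) \<and>
    initial M \<in> states M \<and> accepting M \<subseteq> states M \<and>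
    (\<forall>(q, a, q', b, d) \<in> delta M. q \<in> states M \<and> q' \<in> states M \<and>
      (a \<in> work_alphabet \<Sigma> M \<and> b \<in> work_alphabet \<Sigma> M \<or>
       a = LEnd \<and> b = LEnd \<and> d \<noteq> MoveL \<or>
       a = REnd \<and> b = REnd \<and> d \<noteq> MoveR))"

text \<open>A configuration consists of the state, the head position and the tape contents.\<close>

type_synonym 's config = "nat \<times> nat \<times> 's tape_symbol list"

fun move :: "direction \<Rightarrow> nat \<Rightarrow> nat" where
  "move MoveL i = i - 1"
| "move Stay i = i"
| "move MoveR i = Suc i"

inductive lba_step :: "'s lba \<Rightarrow> 's config \<Rightarrow> 's config \<Rightarrow> bool" for M where
  "i < length t \<Longrightarrow> (q, t ! i, q', b, d) \<in> delta M \<Longrightarrow>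
    lba_step M (q, i, t) (q', move d i, t[i := b])"

definition initial_config :: "'s lba \<Rightarrow> 's list \<Rightarrow> 's config" where
  "initial_config M w = (initial M, 0, LEnd # map Input w @ [REnd])"

definition lba_language :: "'s set \<Rightarrow> 's lba \<Rightarrow> 's list set" where
  "lba_language \<Sigma> M =
    {w \<in> lists \<Sigma>. \<exists>q i t. q \<in> accepting M \<and> (lba_step M)\<^sup>*\<^sup>* (initial_config M w) (q, i, t)}"

definition context_sensitive :: "'s set \<Rightarrow> 's list set \<Rightarrow> bool" where
  "context_sensitive \<Sigma> L \<longleftrightarrow> (\<exists>M. is_lba \<Sigma> M \<and> lba_language \<Sigma> M = L)"


section \<open>The languages of primitive sets and primitive elements\<close>

datatype 'a symbol = Letter "'a letter" | Hash

definition hash_alphabet :: "'a set \<Rightarrow> 'a symbol set" where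
  "hash_alphabet X = insert Hash (Letter ` (X \<times> UNIV))"

fun hash_join :: "'a word list \<Rightarrow> 'a symbol list" where
  "hash_join [] = []"
| "hash_join [w] = map Letter w"
| "hash_join (w # v # ws) = map Letter w @ Hash # hash_join (v # ws)"

text \<open>
  The words are required to be distinct: \<open>{w\<^sub>1, \<dots>, w\<^sub>n}\<close> denotes a set
  with \<open>n\<close> elements. Elements of the carrier of \<open>free_group X\<close> are reduced words.
\<close>

definition primitive_set_language :: "'a set \<Rightarrow> nat \<Rightarrow> 'a symbol list set" where
  "primitive_set_language X n =
    {hash_join ws | ws. length ws = n \<and> distinct ws \<and> set ws \<subseteq> carrier (free_group X) \<and>
      primitive_set (free_group X) (set ws)}"

definition primitive_element_language :: "'a set \<Rightarrow> 'a symbol list set" where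
  "primitive_element_language X =
    {map Letter w | w. w \<in> carrier (free_group X) \<and> primitive_element (free_group X) w}"

end

theory Submission
  imports Defs "HOL-Library.Countable"
begin

text \<open>
  A linearly bounded automaton can guess its way from a primitive set to a set of
  generators, because there is always a Whitehead automorphism that simplifies the
  set merely by deleting letters.

  To see this, extend the set to a basis and consider the rose whose petals are subdivided
  so as to spell the words of this basis. Whenever two edges with the same label start or
  end in the same vertex, fold them. As long as the graph has more than one vertex, a fold
  identifying two vertices is possible: a folded graph whose petals generate the free group
  is a bouquet of circles (\<open>folded_generating_one_vertex\<close>). Each fold loses one vertex and at
  least one edge, so when two vertices are left, there is at most one edge more than there
  are generators (\<open>fold_to_two_vertices\<close>). Every generator is needed, so all of them have a
  single edge, except one letter \<open>\<beta>\<close>, which has a loop and an edge between the two vertices.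
  Collapse the latter. The petals become the words in which the occurrences of \<open>\<beta>\<close>
  along this edge are deleted, and the graph becomes a bouquet whose identification with
  the original one is an automorphism sending \<open>x\<close> to \<open>\<beta>\<^sup>s x \<beta>\<^sup>-\<^sup>t\<close> for exponents
  \<open>s, t \<in> {0, 1}\<close> that depend on \<open>x\<close> (\<open>free_eq_lift_whitehead\<close>). Each edge lies on a petal, so
  the total length decreases (\<open>generating_collapse\<close>). Once all words have length at most 1,
  they are distinct generators or their inverses (\<open>short_generating_letters\<close>).

  The deleted letters are found by walking through a graph with two vertices. So the new
  words are computed by a sweep of a transducer with finitely many states that replaces
  deleted letters by blanks. It treats all words on the tape alike, and it need not know the
  words that extend the given set to a basis. Conversely, as every such sweep can be undone
  by an automorphism, a tape that reaches distinct generators started with a primitive set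
  (\<open>sweeps_sound\<close>). Only reducedness of the words is not preserved backwards; it is checked by
  a first sweep. A sweep, the repetition of a second one and a final one can be carried out
  by a linearly bounded automaton (\<open>context_sensitive_sweeps\<close>).

  That a basis has at most as many elements as there are generators, which the count of
  edges needs, follows by counting homomorphisms to the group of order two
  (\<open>card_free_basis\<close>).
\<close>


section \<open>Free equivalence and substitutions\<close>

abbreviation free_eq :: "'a word \<Rightarrow> 'a word \<Rightarrow> bool"  (infix "\<sim>" 50) where
  "u \<sim> v \<equiv> free_reduce u = free_reduce v"

definition inv_word :: "'a word \<Rightarrow> 'a word" where
  "inv_word w = rev (map inv_letter w)"

lemma inv_word_simps [simp]:
  "inv_word [] = []"
  "inv_word (a # w) = inv_word w @ [inv_letter a]"
  "inv_word (u @ v) = inv_word v @ inv_word u"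
  "inv_word (inv_word w) = w"
  by (simp_all add: inv_word_def rev_map comp_def)

lemma fst_inv_letter [simp]: "fst (inv_letter a) = fst a"
  by (simp add: inv_letter_def)

lemma inv_letter_neq [simp]: "inv_letter a \<noteq> a" "a \<noteq> inv_letter a"
  by (auto simp: inv_letter_def prod_eq_iff)

lemma inv_word_in_lists: "w \<in> lists (X \<times> UNIV) \<Longrightarrow> inv_word w \<in> lists (X \<times> UNIV)"
  by (induction w) (auto simp: inv_letter_def)

lemma free_reduce_append': "free_reduce (u @ v) = foldr push u (free_reduce v)"
  by (simp add: free_reduce_def)

lemma reduced_free_reduce [simp]: "reduced (free_reduce w)"
  by (simp add: free_reduce_def foldr_push_reduced)

lemma free_reduce_free_reduce [simp]: "free_reduce (free_reduce w) = free_reduce w"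
  by (simp add: free_reduce_id)

lemma free_reduce_Nil [simp]: "free_reduce [] = []"
  by (simp add: free_reduce_def)

lemma free_reduce_in_lists: "w \<in> lists A \<Longrightarrow> free_reduce w \<in> lists A"
  unfolding free_reduce_def by (rule foldr_push_in_lists) auto

lemma free_reduce_left [simp]: "free_reduce (free_reduce u @ v) = free_reduce (u @ v)"
  unfolding free_reduce_append' unfolding free_reduce_def[of u]
  by (simp add: foldr_push_foldr)

lemma free_reduce_right [simp]: "free_reduce (u @ free_reduce v) = free_reduce (u @ v)"
  by (simp add: free_reduce_append')

lemma free_eq_append: "u \<sim> u' \<Longrightarrow> v \<sim> v' \<Longrightarrow> u @ v \<sim> u' @ v'"
  by (metis free_reduce_left free_reduce_right)

lemma free_eq_cancel_left [simp]: "inv_word u @ u @ v \<sim> v"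
  by (simp add: free_reduce_append' inv_word_def foldr_push_left_inverse)

lemma free_eq_cancel_right [simp]: "u @ inv_word u @ v \<sim> v"
  using free_eq_cancel_left[of "inv_word u" v] by simp

lemma free_eq_cancel_Nil [simp]: "inv_word u @ u \<sim> []" "u @ inv_word u \<sim> []"
  using free_eq_cancel_left[of u "[]"] free_eq_cancel_right[of u "[]"] by simp_all

lemma free_eq_inv_word:
  assumes "u \<sim> v"
  shows "inv_word u \<sim> inv_word v"
proof -
  have "inv_word u \<sim> inv_word u @ (v @ inv_word v)"
    using free_eq_append[of "inv_word u" "inv_word u" "[]" "v @ inv_word v"] by simp
  also have "inv_word u @ (v @ inv_word v) \<sim> inv_word u @ (u @ inv_word v)"
    using assms by (intro free_eq_append) auto
  also have "inv_word u @ (u @ inv_word v) \<sim> inv_word v"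
    by simp
  finally show ?thesis .
qed

text \<open>
  A substitution assigns words to generators. The generators and the letters of their
  images may have different types: a word over a set of words is evaluated
  in the free group by \<open>lift (\<lambda>w. w)\<close>.
\<close>

definition lift :: "('b \<Rightarrow> 'a word) \<Rightarrow> 'b word \<Rightarrow> 'a word" where
  "lift \<sigma> w = concat (map (\<lambda>(x, b). if b then \<sigma> x else inv_word (\<sigma> x)) w)"

lemma lift_simps [simp]:
  "lift \<sigma> [] = []"
  "lift \<sigma> (a # w) = (if snd a then \<sigma> (fst a) else inv_word (\<sigma> (fst a))) @ lift \<sigma> w"
  "lift \<sigma> (u @ v) = lift \<sigma> u @ lift \<sigma> v"
  by (simp_all add: lift_def case_prod_beta)

lemma lift_inv_word [simp]: "lift \<sigma> (inv_word w) = inv_word (lift \<sigma> w)"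
  by (induction w) (auto simp: inv_letter_def)

lemma lift_lift: "lift \<rho> (lift \<sigma> w) = lift (\<lambda>x. lift \<rho> (\<sigma> x)) w"
  by (induction w) auto

lemma lift_generators [simp]: "lift (\<lambda>x. [(x, True)]) w = w"
  by (induction w) (auto simp: inv_letter_def prod_eq_iff)

lemma lift_in_lists:
  "w \<in> lists (Y \<times> UNIV) \<Longrightarrow> (\<And>y. y \<in> Y \<Longrightarrow> \<sigma> y \<in> lists (X \<times> UNIV)) \<Longrightarrow>
    lift \<sigma> w \<in> lists (X \<times> UNIV)"
proof (induction w)
  case (Cons a w)
  then have "fst a \<in> Y" by auto
  with Cons.prems(2) have "\<sigma> (fst a) \<in> lists (X \<times> UNIV)" by blast
  then show ?case
    using Cons inv_word_in_lists[of "\<sigma> (fst a)" X] by auto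
qed simp

lemma lift_push: "lift \<sigma> (push a w) \<sim> lift \<sigma> (a # w)"
proof (cases w)
  case (Cons b v)
  have "lift \<sigma> (a # inv_letter a # v) \<sim> lift \<sigma> v"
    by (cases "snd a") (simp_all add: inv_letter_def)
  then show ?thesis using Cons by auto
qed simp

text \<open>Substitutions are compatible with free reduction: they induce homomorphisms.\<close>

lemma lift_free_reduce: "lift \<sigma> (free_reduce w) \<sim> lift \<sigma> w"
proof (induction w)
  case (Cons a w)
  have "lift \<sigma> (free_reduce (a # w)) \<sim> lift \<sigma> (a # free_reduce w)"
    using lift_push[of \<sigma> a "free_reduce w"] by (simp add: free_reduce_def)
  also have "lift \<sigma> (a # free_reduce w) \<sim> lift \<sigma> (a # w)"
    using Cons by (auto intro!: free_eq_append)
  finally show ?case .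
qed simp

lemma lift_cong: "u \<sim> v \<Longrightarrow> lift \<sigma> u \<sim> lift \<sigma> v"
  by (metis lift_free_reduce)

lemma lift_cong_generators:
  "w \<in> lists (Y \<times> UNIV) \<Longrightarrow> (\<And>y. y \<in> Y \<Longrightarrow> \<sigma> y \<sim> \<sigma>' y) \<Longrightarrow> lift \<sigma> w \<sim> lift \<sigma>' w"
proof (induction w)
  case (Cons a w)
  then have "\<sigma> (fst a) \<sim> \<sigma>' (fst a)" by auto
  with Cons show ?case
    by (auto intro!: free_eq_append free_eq_inv_word)
qed simp

section \<open>Free bases\<close>

lemma carrier_free_group: "w \<in> carrier (free_group X) \<longleftrightarrow> w \<in> lists (X \<times> UNIV) \<and> reduced w"
  by (auto simp: free_group_def)

lemma mult_free_group: "u \<otimes>\<^bsub>free_group X\<^esub> v = free_reduce (u @ v)"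
  by (simp add: free_group_def)

lemma one_free_group: "\<one>\<^bsub>free_group X\<^esub> = []"
  by (simp add: free_group_def)

lemma inv_free_group:
  assumes "w \<in> carrier (free_group X)"
  shows "inv\<^bsub>free_group X\<^esub> w = free_reduce (inv_word w)"
proof (rule group.inv_equality[OF group_free_group])
  show "free_reduce (inv_word w) \<otimes>\<^bsub>free_group X\<^esub> w = \<one>\<^bsub>free_group X\<^esub>"
    by (simp add: mult_free_group one_free_group)
  show "free_reduce (inv_word w) \<in> carrier (free_group X)"
    using assms free_reduce_in_lists[OF inv_word_in_lists, of w X]
    by (simp add: carrier_free_group del: in_lists_conv_set)
qed (rule assms)

lemma word_eval_free_group:
  assumes "B \<subseteq> carrier (free_group X)" "u \<in> lists (B \<times> UNIV)"
  shows "word_eval (free_group X) u = free_reduce (lift (\<lambda>w. w) u)"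
  using assms(2)
proof (induction u)
  case (Cons a u)
  then have "fst a \<in> carrier (free_group X)" using assms(1) by auto
  with Cons show ?case
    by (simp add: word_eval_def case_prod_beta mult_free_group inv_free_group)
qed (simp add: word_eval_def one_free_group)

text \<open>
  Words \<open>\<sigma> x\<close> that define an automorphism of the free group on \<open>X\<close>. Its inverse is asked
  for as a substitution too, so that the composition with further substitutions is
  again a calculation with words.
\<close>

definition automorphism_words :: "'a set \<Rightarrow> ('a \<Rightarrow> 'a word) \<Rightarrow> bool" where
  "automorphism_words X \<sigma> \<longleftrightarrow>
    (\<forall>x \<in> X. \<sigma> x \<in> lists (X \<times> UNIV)) \<and>
    (\<exists>\<tau>. (\<forall>x \<in> X. \<tau> x \<in> lists (X \<times> UNIV)) \<and>
      (\<forall>x \<in> X. lift \<tau> (\<sigma> x) \<sim> [(x, True)]) \<and> (\<forall>x \<in> X. lift \<sigma> (\<tau> x) \<sim> [(x, True)]))"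

lemma lift_lift_inverse:
  assumes "\<forall>x \<in> X. lift \<tau> (\<sigma> x) \<sim> [(x, True)]" "w \<in> lists (X \<times> UNIV)"
  shows "lift \<tau> (lift \<sigma> w) \<sim> w"
proof -
  have "lift \<tau> (lift \<sigma> w) \<sim> lift (\<lambda>x. [(x, True)]) w"
    unfolding lift_lift using assms by (intro lift_cong_generators) auto
  then show ?thesis by simp
qed

lemma automorphism_words_comp:
  assumes "automorphism_words X \<rho>" "automorphism_words X \<sigma>"
  shows "automorphism_words X (\<lambda>x. lift \<rho> (\<sigma> x))"
proof -
  obtain \<rho>' where \<rho>: "\<forall>x \<in> X. \<rho> x \<in> lists (X \<times> UNIV)" "\<forall>x \<in> X. \<rho>' x \<in> lists (X \<times> UNIV)"
      "\<forall>x \<in> X. lift \<rho>' (\<rho> x) \<sim> [(x, True)]" "\<forall>x \<in> X. lift \<rho> (\<rho>' x) \<sim> [(x, True)]"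
    using assms(1) unfolding automorphism_words_def by blast
  obtain \<sigma>' where \<sigma>: "\<forall>x \<in> X. \<sigma> x \<in> lists (X \<times> UNIV)" "\<forall>x \<in> X. \<sigma>' x \<in> lists (X \<times> UNIV)"
      "\<forall>x \<in> X. lift \<sigma>' (\<sigma> x) \<sim> [(x, True)]" "\<forall>x \<in> X. lift \<sigma> (\<sigma>' x) \<sim> [(x, True)]"
    using assms(2) unfolding automorphism_words_def by blast
  have inverse: "lift (\<lambda>x. lift \<sigma>' (\<rho>' x)) (lift \<rho> (\<sigma> x)) \<sim> [(x, True)]"
    if "x \<in> X" "\<forall>x \<in> X. \<sigma> x \<in> lists (X \<times> UNIV)" "\<forall>x \<in> X. lift \<rho>' (\<rho> x) \<sim> [(x, True)]"
      "\<forall>x \<in> X. lift \<sigma>' (\<sigma> x) \<sim> [(x, True)]" for \<rho> \<rho>' \<sigma> \<sigma>' :: "'a \<Rightarrow> 'a word" and x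
  proof -
    have "lift \<rho>' (lift \<rho> (\<sigma> x)) \<sim> \<sigma> x"
      using that by (intro lift_lift_inverse) auto
    then have "lift \<sigma>' (lift \<rho>' (lift \<rho> (\<sigma> x))) \<sim> lift \<sigma>' (\<sigma> x)"
      by (rule lift_cong)
    then show ?thesis using that by (simp add: lift_lift)
  qed
  show ?thesis
    unfolding automorphism_words_def
  proof (intro conjI exI[of _ "\<lambda>x. lift \<sigma>' (\<rho>' x)"] ballI)
    fix x assume x: "x \<in> X"
    show "lift \<rho> (\<sigma> x) \<in> lists (X \<times> UNIV)" using \<rho>(1) \<sigma>(1) x by (intro lift_in_lists) blast+
    show "lift \<sigma>' (\<rho>' x) \<in> lists (X \<times> UNIV)" using \<rho>(2) \<sigma>(2) x by (intro lift_in_lists) blast+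
    show "lift (\<lambda>x. lift \<sigma>' (\<rho>' x)) (lift \<rho> (\<sigma> x)) \<sim> [(x, True)]"
      using x \<rho> \<sigma> by (intro inverse)
    show "lift (\<lambda>x. lift \<rho> (\<sigma> x)) (lift \<sigma>' (\<rho>' x)) \<sim> [(x, True)]"
      using x \<rho> \<sigma> by (intro inverse)
  qed
qed

lemma automorphism_words_inj:
  assumes "automorphism_words X \<sigma>"
  shows "inj_on (\<lambda>x. free_reduce (\<sigma> x)) X"
proof (rule inj_onI)
  obtain \<tau> where \<tau>: "\<forall>x \<in> X. lift \<tau> (\<sigma> x) \<sim> [(x, True)]"
    using assms unfolding automorphism_words_def by blast
  fix x y assume "x \<in> X" "y \<in> X" "\<sigma> x \<sim> \<sigma> y"
  then have "[(x, True)] \<sim> [(y, True)]"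
    using \<tau> lift_cong[of "\<sigma> x" "\<sigma> y" \<tau>] by metis
  then show "x = y" by (simp add: free_reduce_def)
qed

lemma reduced_map_inj:
  assumes "inj_on f X" "w \<in> lists (X \<times> UNIV)"
  shows "reduced (map (\<lambda>(x, b). (f x, b)) w) \<longleftrightarrow> reduced w"
  using assms(2)
proof (induction w rule: list.induct)
  case (Cons a w)
  note IH = Cons.IH and prems = Cons.prems
  show ?case
  proof (cases w)
    case Nil
    then show ?thesis by (simp add: reduced_Cons)
  next
    case (Cons b v)
    with prems have "fst b \<in> X" "fst a \<in> X" by auto
    then have "f (fst b) = f (fst a) \<longleftrightarrow> fst b = fst a"
      using assms(1) by (simp add: inj_on_eq_iff)
    then show ?thesis
      using Cons IH prems by (auto simp: reduced_Cons inv_letter_def prod_eq_iff case_prod_beta)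
  qed
qed simp

text \<open>
  The inverse substitution rewrites any element in the letters \<open>\<sigma> x\<close>. This gives
  surjectivity, and injectivity as different reduced words in these letters come from
  different reduced words over \<open>X\<close>.
\<close>

lemma free_basis_automorphism:
  assumes "automorphism_words X \<sigma>"
  shows "free_basis (free_group X) ((\<lambda>x. free_reduce (\<sigma> x)) ` X)"
proof -
  let ?F = "free_group X"
  define f where "f x = free_reduce (\<sigma> x)" for x
  let ?B = "f ` X"
  obtain \<tau> where \<sigma>: "\<forall>x \<in> X. \<sigma> x \<in> lists (X \<times> UNIV)" "\<forall>x \<in> X. \<tau> x \<in> lists (X \<times> UNIV)"
      "\<forall>x \<in> X. lift \<tau> (\<sigma> x) \<sim> [(x, True)]" "\<forall>x \<in> X. lift \<sigma> (\<tau> x) \<sim> [(x, True)]"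
    using assms unfolding automorphism_words_def by blast
  have inj: "inj_on f X"
    using automorphism_words_inj[OF assms] by (simp add: f_def[abs_def])
  have B: "?B \<subseteq> carrier ?F"
  proof
    fix g assume "g \<in> ?B"
    then obtain x where "x \<in> X" "g = f x" by blast
    then show "g \<in> carrier ?F"
      using free_reduce_in_lists[of "\<sigma> x" "X \<times> UNIV"] \<sigma>(1)
      by (simp add: carrier_free_group f_def del: in_lists_conv_set)
  qed
  note eval = word_eval_free_group[OF B]
  let ?m = "map (\<lambda>(x, b). (f x, b))"
  have eval_map: "lift (\<lambda>w. w) (?m w) \<sim> lift \<sigma> w" if "w \<in> lists (X \<times> UNIV)" for w
  proof -
    have "lift (\<lambda>w. w) (?m w) = lift f w"
      by (induction w) (auto simp: case_prod_beta)
    also have "\<dots> \<sim> lift \<sigma> w"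
      using that by (rule lift_cong_generators) (simp add: f_def)
    finally show ?thesis .
  qed
  have eval_in: "word_eval ?F u \<in> carrier ?F" if "u \<in> lists (?B \<times> UNIV)" for u
  proof -
    have "lift (\<lambda>w. w) u \<in> lists (X \<times> UNIV)"
      using that
    proof (rule lift_in_lists)
      show "g \<in> lists (X \<times> UNIV)" if "g \<in> ?B" for g
        using B that carrier_free_group by blast
    qed
    then show ?thesis
      unfolding eval[OF that] carrier_free_group using free_reduce_in_lists by auto
  qed
  have hom: "word_eval ?F \<in> hom (free_group ?B) ?F"
  proof (rule homI)
    fix u v assume "u \<in> carrier (free_group ?B)" "v \<in> carrier (free_group ?B)"
    then have "u \<in> lists (?B \<times> UNIV)" "v \<in> lists (?B \<times> UNIV)"
      by (auto simp: carrier_free_group)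
    moreover from this have "free_reduce (u @ v) \<in> lists (?B \<times> UNIV)"
      by (intro free_reduce_in_lists) auto
    ultimately show "word_eval ?F (u \<otimes>\<^bsub>free_group ?B\<^esub> v) = word_eval ?F u \<otimes>\<^bsub>?F\<^esub> word_eval ?F v"
      by (simp add: mult_free_group eval lift_free_reduce del: in_lists_conv_set)
  qed (use eval_in in \<open>auto simp: carrier_free_group\<close>)
  have unmap: "\<exists>w. u = ?m w \<and> w \<in> lists (X \<times> UNIV)" if "u \<in> lists (?B \<times> UNIV)" for u
    using that
  proof (induction u rule: list.induct)
    case (Cons a u)
    then obtain w where "u = ?m w \<and> w \<in> lists (X \<times> UNIV)" by auto
    moreover have "fst a \<in> f ` X" using Cons.prems by (auto simp: image_iff)
    then obtain x where "fst a = f x" "x \<in> X" by blast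
    ultimately show ?case
      by (intro exI[of _ "(x, snd a) # w"]) (auto simp: prod_eq_iff)
  qed simp
  have "inj_on (word_eval ?F) (carrier (free_group ?B))"
  proof (rule inj_onI)
    fix u v
    assume u: "u \<in> carrier (free_group ?B)" and v: "v \<in> carrier (free_group ?B)"
      and eq: "word_eval ?F u = word_eval ?F v"
    obtain u' v' where u': "u = ?m u'" "u' \<in> lists (X \<times> UNIV)"
        and v': "v = ?m v'" "v' \<in> lists (X \<times> UNIV)"
      using u v unmap[of u] unmap[of v] unfolding carrier_free_group by blast
    have "reduced u'" "reduced v'"
      using u v u' v' reduced_map_inj[OF inj] unfolding carrier_free_group by auto
    have "lift \<sigma> u' \<sim> lift \<sigma> v'"
      using eq u v u' v' eval_map[of u'] eval_map[of v'] eval[of u] eval[of v]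
      unfolding carrier_free_group by auto
    then have "lift \<tau> (lift \<sigma> u') \<sim> lift \<tau> (lift \<sigma> v')"
      by (rule lift_cong)
    then have "u' \<sim> v'"
      using lift_lift_inverse[OF \<sigma>(3)] u'(2) v'(2) by metis
    then show "u = v"
      using \<open>reduced u'\<close> \<open>reduced v'\<close> u'(1) v'(1) by (simp add: free_reduce_id)
  qed
  moreover have "word_eval ?F ` carrier (free_group ?B) = carrier ?F"
  proof
    show "word_eval ?F ` carrier (free_group ?B) \<subseteq> carrier ?F"
      using eval_in by (auto simp: carrier_free_group)
    show "carrier ?F \<subseteq> word_eval ?F ` carrier (free_group ?B)"
    proof
      fix g assume g: "g \<in> carrier ?F"
      let ?w = "free_reduce (lift \<tau> g)"
      have w: "?w \<in> lists (X \<times> UNIV)"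
        using g \<sigma>(2) by (intro free_reduce_in_lists lift_in_lists[of g X]) (auto simp: carrier_free_group)
      have mw: "?m ?w \<in> lists (?B \<times> UNIV)"
        using w by fastforce
      then have "?m ?w \<in> carrier (free_group ?B)"
        using reduced_map_inj[OF inj w] by (simp add: carrier_free_group del: in_lists_conv_set)
      moreover have "word_eval ?F (?m ?w) = g"
      proof -
        have "word_eval ?F (?m ?w) = free_reduce (lift \<sigma> (lift \<tau> g))"
          using eval[OF mw] eval_map[OF w] by (simp add: lift_free_reduce)
        also have "\<dots> = free_reduce g"
          using g by (intro lift_lift_inverse[OF \<sigma>(4)]) (simp add: carrier_free_group)
        finally show ?thesis using g by (simp add: carrier_free_group free_reduce_id)
      qed
      ultimately show "g \<in> word_eval ?F ` carrier (free_group ?B)" by force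
    qed
  qed
  ultimately have "word_eval ?F \<in> iso (free_group ?B) ?F"
    using hom by (simp add: iso_def bij_betw_def)
  then show ?thesis
    using B by (simp add: free_basis_def f_def)
qed


section \<open>Generating sets\<close>

inductive generates :: "'a word set \<Rightarrow> 'a word \<Rightarrow> bool" for S where
  generates_Nil: "generates S []"
| generates_append: "b \<in> S \<Longrightarrow> generates S w \<Longrightarrow> generates S (b @ w)"
| generates_inv: "b \<in> S \<Longrightarrow> generates S w \<Longrightarrow> generates S (inv_word b @ w)"
| generates_eq: "generates S u \<Longrightarrow> u \<sim> v \<Longrightarrow> generates S v"

definition generating :: "'a set \<Rightarrow> 'a word set \<Rightarrow> bool" where
  "generating X S \<longleftrightarrow> (\<forall>w \<in> lists (X \<times> UNIV). generates S w)"

lemma generates_lift: "u \<in> lists (S \<times> UNIV) \<Longrightarrow> generates S (lift (\<lambda>w. w) u)"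
  by (induction u) (auto intro: generates.intros)

lemma generates_letters:
  assumes "generates S w" "\<And>b. b \<in> S \<Longrightarrow> b \<in> lists (Y \<times> UNIV)"
  shows "free_reduce w \<in> lists (Y \<times> UNIV)"
  using assms(1)
proof induction
  case (generates_append b w)
  then show ?case
    using assms(2) unfolding free_reduce_append' by (intro foldr_push_in_lists)
next
  case (generates_inv b w)
  then show ?case
    using assms(2) inv_word_in_lists unfolding free_reduce_append'
    by (intro foldr_push_in_lists) blast+
qed simp_all

lemma generating_letters:
  assumes "generating X S" "x \<in> X"
  shows "\<exists>b \<in> S. x \<in> fst ` set b"
proof -
  let ?Y = "\<Union>b \<in> S. fst ` set b"
  have "generates S [(x, True)]"
    using assms by (auto simp: generating_def)
  then have "free_reduce [(x, True)] \<in> lists (?Y \<times> UNIV)"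
    by (rule generates_letters) (force simp: image_iff)
  then show ?thesis by (simp add: free_reduce_def)
qed

lemma list_all2_mem: "list_all2 P xs ys \<Longrightarrow> x \<in> set xs \<Longrightarrow> \<exists>y \<in> set ys. P x y"
  by (induction rule: list_all2_induct) auto

lemma generates_image:
  assumes "generates (set bs) w" "list_all2 (\<lambda>b b'. lift \<tau> b \<sim> b') bs bs'"
  shows "generates (set bs') (lift \<tau> w)"
  using assms(1)
proof induction
  case (generates_append b w)
  obtain b' where b': "b' \<in> set bs'" "lift \<tau> b \<sim> b'"
    using list_all2_mem[OF assms(2) generates_append(1)] by blast
  have "b' @ lift \<tau> w \<sim> lift \<tau> (b @ w)"
    using b' by (auto intro: free_eq_append)
  then show ?case
    using generates.generates_append[OF b'(1) generates_append.IH] by (blast intro: generates_eq)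
next
  case (generates_inv b w)
  obtain b' where b': "b' \<in> set bs'" "lift \<tau> b \<sim> b'"
    using list_all2_mem[OF assms(2) generates_inv(1)] by blast
  have "inv_word b' @ lift \<tau> w \<sim> lift \<tau> (inv_word b @ w)"
    using free_eq_inv_word[OF b'(2)] by (auto intro: free_eq_append)
  then show ?case
    using generates.generates_inv[OF b'(1) generates_inv.IH] by (blast intro: generates_eq)
next
  case (generates_eq u v)
  then show ?case using lift_cong by (blast intro: generates.generates_eq)
qed (simp add: generates_Nil)

lemma generating_automorphism:
  assumes "generating X (set bs)" "automorphism_words X \<theta>"
    and "list_all2 (\<lambda>b b'. b \<sim> lift \<theta> b') bs bs'" "set bs' \<subseteq> lists (X \<times> UNIV)"
  shows "generating X (set bs')"
  unfolding generating_def
proof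
  fix w :: "'a word" assume w: "w \<in> lists (X \<times> UNIV)"
  obtain \<tau> where \<theta>: "\<forall>x \<in> X. \<theta> x \<in> lists (X \<times> UNIV)" "\<forall>x \<in> X. lift \<tau> (\<theta> x) \<sim> [(x, True)]"
    using assms(2) unfolding automorphism_words_def by blast
  have "list_all2 (\<lambda>b b'. lift \<tau> b \<sim> b') bs bs'"
    unfolding list_all2_conv_all_nth
  proof (intro conjI allI impI)
    show len: "length bs = length bs'" using assms(3) by (rule list_all2_lengthD)
    fix i assume i: "i < length bs"
    then have "lift \<tau> (bs ! i) \<sim> lift \<tau> (lift \<theta> (bs' ! i))"
      using assms(3) by (intro lift_cong) (simp add: list_all2_conv_all_nth)
    also have "lift \<tau> (lift \<theta> (bs' ! i)) \<sim> bs' ! i"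
    proof (rule lift_lift_inverse[OF \<theta>(2)])
      show "bs' ! i \<in> lists (X \<times> UNIV)" using i len assms(4) by (metis nth_mem subsetD)
    qed
    finally show "lift \<tau> (bs ! i) \<sim> bs' ! i" .
  qed
  moreover have "generates (set bs) (lift \<theta> w)"
    using assms(1) lift_in_lists[OF w, of \<theta> X] \<theta>(1) unfolding generating_def by blast
  ultimately have "generates (set bs') (lift \<tau> (lift \<theta> w))"
    by (blast intro: generates_image)
  then show "generates (set bs') w"
    using lift_lift_inverse[OF \<theta>(2) w] by (rule generates_eq)
qed


section \<open>Folding a rose\<close>

text \<open>
  A step \<open>(p, a, q)\<close> walks from the vertex \<open>p\<close> to the vertex \<open>q\<close> reading the letter \<open>a\<close>. It
  uses an edge of a labelled directed graph, against its direction if the letter is an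
  inverse.
\<close>

type_synonym ('v, 'a) step = "'v \<times> 'a letter \<times> 'v"

fun edge :: "('v, 'a) step \<Rightarrow> 'v \<times> 'a \<times> 'v" where
  "edge (p, (x, b), q) = (if b then (p, x, q) else (q, x, p))"

fun walk :: "'v \<Rightarrow> ('v, 'a) step list \<Rightarrow> 'v \<Rightarrow> bool" where
  "walk p [] q \<longleftrightarrow> p = q"
| "walk p (s # \<pi>) q \<longleftrightarrow> p = fst s \<and> walk (snd (snd s)) \<pi> q"

abbreviation label :: "('v, 'a) step list \<Rightarrow> 'a word" where
  "label \<pi> \<equiv> map (\<lambda>s. fst (snd s)) \<pi>"

fun reads :: "('v \<times> 'a \<times> 'v) set \<Rightarrow> 'v \<Rightarrow> 'a word \<Rightarrow> 'v \<Rightarrow> bool" where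
  "reads E p [] q \<longleftrightarrow> p = q"
| "reads E p (a # w) q \<longleftrightarrow> (\<exists>r. edge (p, a, r) \<in> E \<and> reads E r w q)"

text \<open>
  Folded graphs: no two edges with the same label start, or end, in the same vertex. Both
  directions are covered since \<open>a\<close> ranges over the generators and their inverses.
\<close>

definition folded :: "('v \<times> 'a \<times> 'v) set \<Rightarrow> bool" where
  "folded E \<longleftrightarrow> (\<forall>p a q r. edge (p, a, q) \<in> E \<longrightarrow> edge (p, a, r) \<in> E \<longrightarrow> q = r)"

lemma edge_inv_letter [simp]: "edge (p, inv_letter a, q) = edge (q, a, p)"
  by (cases a) (simp add: inv_letter_def)

lemma edge_eq_cases: "edge s = edge (p, a, q) \<Longrightarrow> s = (p, a, q) \<or> s = (q, inv_letter a, p)"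
  by (cases s; cases a) (auto simp: inv_letter_def split: if_splits prod.splits)

lemma edge_letter: "fst (snd (edge (p, a, q))) = fst a"
  by (cases a) simp

lemma reads_append: "reads E p u q \<Longrightarrow> reads E q v r \<Longrightarrow> reads E p (u @ v) r"
  by (induction u arbitrary: p) auto

lemma reads_inv_word: "reads E p w q \<Longrightarrow> reads E q (inv_word w) p"
  by (induction w arbitrary: p) (auto intro!: reads_append)

lemma reads_push:
  assumes "folded E" "edge (p, a, q) \<in> E" "reads E q w r"
  shows "reads E p (push a w) r"
proof (cases w)
  case (Cons b v)
  show ?thesis
  proof (cases "b = inv_letter a")
    case True
    then obtain p' where "edge (q, inv_letter a, p') \<in> E" "reads E p' v r"
      using assms(3) Cons by auto
    moreover have "edge (q, inv_letter a, p) \<in> E" using assms(2) by simp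
    ultimately have "p' = p" using assms(1) unfolding folded_def by blast
    then show ?thesis
      using \<open>reads E p' v r\<close> Cons True by simp
  qed (use assms Cons in auto)
qed (use assms in auto)

lemma reads_foldr_push:
  assumes "folded E" "reads E q v r"
  shows "reads E p u q \<Longrightarrow> reads E p (foldr push u v) r"
  using assms by (induction u arbitrary: p) (auto intro: reads_push)

lemma reads_generates:
  assumes "folded E" "\<And>b. b \<in> S \<Longrightarrow> reads E v b v" "generates S w"
  shows "reads E v (free_reduce w) v"
  using assms(3)
proof induction
  case (generates_append b w)
  show ?case
    unfolding free_reduce_append'
    using reads_foldr_push[OF assms(1) generates_append(3)] assms(2)[OF generates_append(1)] by blast
next
  case (generates_inv b w)
  show ?case
    unfolding free_reduce_append'
    using reads_foldr_push[OF assms(1) generates_inv(3)]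
      reads_inv_word[OF assms(2)[OF generates_inv(1)]] by blast
qed simp_all

lemma walk_reads: "walk p \<pi> q \<Longrightarrow> edge ` set \<pi> \<subseteq> E \<Longrightarrow> reads E p (label \<pi>) q"
  by (induction \<pi> arbitrary: p) auto

text \<open>
  A rose with base point \<open>v\<close> is given by the closed walks along its petals; its graph
  consists of what these walks visit, so it has no dangling parts.
\<close>

definition steps :: "('v, 'a) step list list \<Rightarrow> ('v, 'a) step set" where
  "steps ps = \<Union> (set ` set ps)"

definition vertices :: "'v \<Rightarrow> ('v, 'a) step list list \<Rightarrow> 'v set" where
  "vertices v ps = insert v (\<Union>(p, a, q) \<in> steps ps. {p, q})"

definition petals :: "'a set \<Rightarrow> 'v \<Rightarrow> ('v, 'a) step list list \<Rightarrow> bool" where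
  "petals X v ps \<longleftrightarrow> (\<forall>\<pi> \<in> set ps. walk v \<pi> v \<and> label \<pi> \<in> lists (X \<times> UNIV))"

lemma finite_steps [simp]: "finite (steps ps)"
  by (simp add: steps_def)

lemma finite_vertices [simp]: "finite (vertices v ps)"
  by (auto simp: vertices_def)

lemma edge_vertices:
  "edge (p, a, q) \<in> edge ` steps ps \<Longrightarrow> p \<in> vertices v ps \<and> q \<in> vertices v ps"
proof -
  assume "edge (p, a, q) \<in> edge ` steps ps"
  then obtain s where "s \<in> steps ps" "edge s = edge (p, a, q)" by auto
  then have "(p, a, q) \<in> steps ps \<or> (q, inv_letter a, p) \<in> steps ps"
    using edge_eq_cases by metis
  then show ?thesis unfolding vertices_def by blast
qed

text \<open>
  In a folded graph, a word labelling a closed walk at the base point still does so after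
  free reduction. If the petals generate the free group, every generator thus has a loop at
  the base point; being the only edge there with its label, it keeps all walks there.
\<close>

lemma folded_generating_one_vertex:
  assumes "petals X v ps" "folded (edge ` steps ps)" "generating X (set (map label ps))"
  shows "vertices v ps = {v}"
proof -
  let ?E = "edge ` steps ps"
  have loop: "edge (v, a, v) \<in> ?E" if "a \<in> X \<times> UNIV" for a
  proof -
    have "reads ?E v b v" if "b \<in> set (map label ps)" for b
    proof -
      have "b \<in> label ` set ps" using that by simp
      then obtain \<pi> where "\<pi> \<in> set ps" "b = label \<pi>" by blast
      then show ?thesis
        using assms(1) by (auto intro!: walk_reads simp: petals_def steps_def)
    qed
    moreover have "generates (set (map label ps)) [a]"
      using assms(3) that by (auto simp: generating_def)
    ultimately have "reads ?E v (free_reduce [a]) v"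
      by (intro reads_generates[OF assms(2)])
    then show ?thesis by (simp add: free_reduce_def)
  qed
  have stay: "\<forall>s \<in> set \<pi>. fst s = v \<and> snd (snd s) = v"
    if "walk p \<pi> q" "p = v" "set \<pi> \<subseteq> steps ps" "label \<pi> \<in> lists (X \<times> UNIV)" for p \<pi> q
    using that
  proof (induction \<pi> arbitrary: p)
    case (Cons s \<pi>)
    obtain a r where s: "s = (v, a, r)"
      using Cons.prems by (cases s) auto
    have "edge (v, a, r) \<in> ?E" "edge (v, a, v) \<in> ?E"
      using Cons.prems loop[of a] s by auto
    then have "r = v" using assms(2) unfolding folded_def by blast
    then show ?case using Cons s by auto
  qed simp
  have "p = v \<and> q = v" if step: "(p, a, q) \<in> steps ps" for p a q
  proof -
    obtain \<pi> where "\<pi> \<in> set ps" "(p, a, q) \<in> set \<pi>"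
      using step unfolding steps_def by blast
    then show ?thesis
      using stay[of v \<pi> v] assms(1) by (force simp: petals_def steps_def)
  qed
  then show ?thesis by (auto simp: vertices_def)
qed

lemma card_image_less:
  assumes "finite E" "e \<in> E" "e' \<in> E" "e \<noteq> e'" "f e = f e'"
  shows "card (f ` E) < card E"
proof -
  have "\<not> inj_on f E" using assms by (auto simp: inj_on_def)
  then have "card (f ` E) \<noteq> card E" using assms(1) eq_card_imp_inj_on by blast
  then show ?thesis using card_image_le[OF assms(1), of f] by simp
qed

text \<open>
  One fold identifies two vertices, and thereby at least two edges. So the inequality
  below, which bounds the rank of the graph by \<open>K\<close>, is kept by folding.
\<close>

lemma fold_step:
  assumes "petals X (v :: 'v) ps" "card (edge ` steps ps) + 1 \<le> card (vertices v ps) + K"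
    and edges: "edge (p, a, q) \<in> edge ` steps ps" "edge (p, a, r) \<in> edge ` steps ps" "q \<noteq> r"
  shows "\<exists>(v' :: 'v) ps'. petals X v' ps' \<and> map label ps' = map label ps \<and>
    card (edge ` steps ps') + 1 \<le> card (vertices v' ps') + K \<and>
    Suc (card (vertices v' ps')) = card (vertices v ps)"
proof -
  define f where "f x = (if x = r then q else x)" for x
  define fs where "fs = (\<lambda>(p, a :: 'a letter, q). (f p, a, f q))"
  define fe where "fe = (\<lambda>(p, x :: 'a, q). (f p, x, f q))"
  have edge_fs: "edge (fs s) = fe (edge s)" for s
    by (cases s) (auto simp: fs_def fe_def)
  define ps' where "ps' = map (map fs) ps"
  have steps': "steps ps' = fs ` steps ps"
    by (auto simp: steps_def ps'_def)
  have label: "label (map fs \<pi>) = label \<pi>" for \<pi>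
    by (auto simp: fs_def)
  have "walk (f p) (map fs \<pi>) (f q)" if "walk p \<pi> q" for p \<pi> q
    using that by (induction \<pi> arbitrary: p) (auto simp: fs_def)
  then have petals: "petals X (f v) ps'"
    using assms(1) by (auto simp: petals_def ps'_def comp_def label simp del: map_map)
  have verts: "vertices (f v) ps' = f ` vertices v ps"
    by (simp add: vertices_def steps' fs_def case_prod_beta image_UN)
  have qr: "q \<in> vertices v ps" "r \<in> vertices v ps"
    using edges edge_vertices[of _ _ _ ps v] by blast+
  then have "f ` vertices v ps = vertices v ps - {r}"
    using edges(3) by (auto simp: f_def image_iff)
  then have card_verts: "Suc (card (vertices (f v) ps')) = card (vertices v ps)"
    using qr(2) verts by (metis card_Suc_Diff1 finite_vertices)
  let ?e = "edge (p, a, q)" and ?e' = "edge (p, a, r)"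
  have neq: "?e \<noteq> ?e'"
    using edges(3) by (cases a) auto
  moreover have "fe ?e = fe ?e'"
    by (cases a) (simp add: fe_def f_def)
  ultimately have "card (fe ` edge ` steps ps) < card (edge ` steps ps)"
    using edges(1,2) neq by (intro card_image_less[of _ ?e ?e']) auto
  moreover have "edge ` steps ps' = fe ` edge ` steps ps"
    unfolding steps' image_image edge_fs ..
  ultimately have "Suc (card (edge ` steps ps')) \<le> card (edge ` steps ps)"
    by simp
  moreover have "map label ps' = map label ps"
    by (auto simp: ps'_def fs_def)
  ultimately show ?thesis
    using petals assms(2) card_verts by (intro exI[of _ "f v"] exI[of _ ps'] conjI) simp_all
qed

lemma fold_to_two_vertices:
  assumes "petals X (v :: 'v) ps" "card (edge ` steps ps) + 1 \<le> card (vertices v ps) + K"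
    and "generating X (set (map label ps))" "card (vertices v ps) \<ge> 2"
  shows "\<exists>(v' :: 'v) ps'. petals X v' ps' \<and> map label ps' = map label ps \<and>
    card (vertices v' ps') = 2 \<and> card (edge ` steps ps') \<le> Suc K"
  using assms
proof (induction "card (vertices v ps)" arbitrary: v ps rule: less_induct)
  case less
  show ?case
  proof (cases "card (vertices v ps) = 2")
    case True
    then show ?thesis using less.prems by (intro exI[of _ v] exI[of _ ps]) auto
  next
    case False
    have "\<not> folded (edge ` steps ps)"
    proof
      assume "folded (edge ` steps ps)"
      then have "vertices v ps = {v}"
        using less.prems by (intro folded_generating_one_vertex)
      then show False using less.prems(4) by simp
    qed
    then obtain p a q r where
      "edge (p, a, q) \<in> edge ` steps ps" "edge (p, a, r) \<in> edge ` steps ps" "q \<noteq> r"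
      unfolding folded_def by blast
    from fold_step[OF less.prems(1,2) this]
    obtain v' :: 'v and ps' where ps': "petals X v' ps'" "map label ps' = map label ps"
        "card (edge ` steps ps') + 1 \<le> card (vertices v' ps') + K"
        "Suc (card (vertices v' ps')) = card (vertices v ps)"
      by blast
    have "\<exists>(v'' :: 'v) ps''. petals X v'' ps'' \<and> map label ps'' = map label ps' \<and>
        card (vertices v'' ps'') = 2 \<and> card (edge ` steps ps'') \<le> Suc K"
      using ps' less.prems False by (intro less.hyps) auto
    then show ?thesis using ps'(2) by auto
  qed
qed

fun path :: "(nat \<Rightarrow> 'v) \<Rightarrow> nat \<Rightarrow> 'a word \<Rightarrow> ('v, 'a) step list" where
  "path f k [] = []"
| "path f k (a # w) = (f k, a, f (Suc k)) # path f (Suc k) w"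

lemma walk_path: "walk (f k) (path f k w) (f (k + length w))"
proof (induction w arbitrary: k)
  case (Cons a w)
  from Cons[of "Suc k"] show ?case by simp
qed simp

lemma label_path: "label (path f k w) = w"
  by (induction w arbitrary: k) auto

lemma set_path: "set (path f k w) = (\<lambda>j. (f (k + j), w ! j, f (Suc (k + j)))) ` {..<length w}"
  by (induction w arbitrary: k) (simp_all add: lessThan_Suc_eq_insert_0 image_image del: image_Suc_lessThan)

text \<open>
  The subdivided rose whose petals spell given words. Its rank is at most the number of
  petals; a petal that spells the empty word is degenerate and adds nothing.
\<close>

lemma subdivided_rose:
  assumes "set bs \<subseteq> lists (X \<times> UNIV)"
  shows "\<exists>(v :: nat \<times> nat) ps. petals X v ps \<and> map label ps = bs \<and>
    card (edge ` steps ps) + 1 \<le> card (vertices v ps) + length bs \<and>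
    ((\<exists>b \<in> set bs. length b \<ge> 2) \<longrightarrow> card (vertices v ps) \<ge> 2)"
proof -
  define n where "n = length bs"
  define len where "len i = length (bs ! i)" for i
  define f where "f i j = (if j = 0 \<or> j = len i then (0, 0) else (i, j))" for i j :: nat
  define ps where "ps = map (\<lambda>i. path (f i) 0 (bs ! i)) [0..<n]"
  define V where "V = insert (0, 0) (SIGMA i:{..<n}. {1..<len i})"
  have "walk (0, 0) (path (f i) 0 (bs ! i)) (0, 0)" for i
    using walk_path[of "f i" 0 "bs ! i"] by (simp add: f_def len_def)
  then have petals: "petals X (0, 0) ps"
    using assms nth_mem by (fastforce simp: petals_def ps_def label_path n_def)
  have label: "map label ps = bs"
    by (simp add: ps_def comp_def label_path n_def map_nth)
  have steps: "steps ps = (\<Union>i<n. (\<lambda>j. (f i j, bs ! i ! j, f i (Suc j))) ` {..<len i})"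
    by (auto simp: steps_def ps_def set_path len_def)
  have "V \<subseteq> vertices (0, 0) ps"
  proof
    fix x assume "x \<in> V"
    then consider "x = (0, 0)" | i j where "x = (i, j)" "i < n" "1 \<le> j" "j < len i"
      by (auto simp: V_def)
    then show "x \<in> vertices (0, 0) ps"
    proof cases
      case (2 i j)
      then have "f i j = x" by (simp add: f_def)
      moreover have "(f i j, bs ! i ! j, f i (Suc j)) \<in> steps ps"
        using 2 by (auto simp: steps)
      ultimately show ?thesis unfolding vertices_def by blast
    qed (simp add: vertices_def)
  qed
  then have verts: "card V \<le> card (vertices (0, 0) ps)"
    by (intro card_mono) auto
  have card_V: "card V = Suc (\<Sum>i<n. len i - 1)"
    by (simp add: V_def)
  have "card (edge ` steps ps) \<le> card (steps ps)"
    by (rule card_image_le) simp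
  also have "\<dots> \<le> (\<Sum>i<n. card ((\<lambda>j. (f i j, bs ! i ! j, f i (Suc j))) ` {..<len i}))"
    unfolding steps by (rule card_UN_le) simp
  also have "\<dots> \<le> (\<Sum>i<n. len i)"
    by (intro sum_mono order.trans[OF card_image_le]) auto
  also have "\<dots> \<le> (\<Sum>i<n. (len i - 1) + 1)"
    by (intro sum_mono) auto
  also have "\<dots> = (\<Sum>i<n. len i - 1) + n"
    by (subst sum.distrib) simp
  finally have "card (edge ` steps ps) + 1 \<le> card (vertices (0, 0) ps) + length bs"
    using verts card_V by (simp add: n_def)
  moreover have "card (vertices (0, 0) ps) \<ge> 2" if b: "b \<in> set bs" "length b \<ge> 2" for b
  proof -
    obtain i where "i < n" "len i \<ge> 2"
      using b by (auto simp: in_set_conv_nth n_def len_def)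
    then have "1 \<le> (\<Sum>i<n. len i - 1)"
      using member_le_sum[of i "{..<n}" "\<lambda>i. len i - 1"] by auto
    then show ?thesis using verts card_V by simp
  qed
  ultimately show ?thesis
    using petals label by (intro exI[of _ "(0, 0)"] exI[of _ ps]) blast
qed


section \<open>Whitehead automorphisms that delete letters\<close>

text \<open>
  Transitions of a walk in a graph with the two vertices \<open>False\<close>, which is the base point,
  and \<open>True\<close>, when the edge \<open>\<beta>\<close> from \<open>False\<close> to \<open>True\<close> is collapsed. A
  generator \<open>x\<close> other than that of \<open>\<beta>\<close> has a single edge; it starts in \<open>x \<in> S\<close> and ends
  in \<open>x \<in> T\<close>. There may be a loop \<open>\<beta>\<close> at either vertex. The collapsed edge is read
  without output.
\<close>

inductive collapse ::
    "'a letter \<Rightarrow> 'a set \<Rightarrow> 'a set \<Rightarrow> bool \<Rightarrow> 'a letter \<Rightarrow> 'a letter option \<Rightarrow> bool \<Rightarrow> bool"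
  for \<beta> S T where
  along: "x \<noteq> fst \<beta> \<Longrightarrow> collapse \<beta> S T (x \<in> S) (x, True) (Some (x, True)) (x \<in> T)"
| against: "x \<noteq> fst \<beta> \<Longrightarrow> collapse \<beta> S T (x \<in> T) (x, False) (Some (x, False)) (x \<in> S)"
| loop: "fst a = fst \<beta> \<Longrightarrow> collapse \<beta> S T p a (Some a) p"
| delete: "collapse \<beta> S T False \<beta> None True"
| delete_inv: "collapse \<beta> S T True (inv_letter \<beta>) None False"

fun cons_option :: "'c option \<Rightarrow> 'c list \<Rightarrow> 'c list" where
  "cons_option None w = w"
| "cons_option (Some a) w = a # w"

inductive collapse_word ::
    "'a letter \<Rightarrow> 'a set \<Rightarrow> 'a set \<Rightarrow> bool \<Rightarrow> 'a word \<Rightarrow> 'a word \<Rightarrow> bool \<Rightarrow> bool"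
  for \<beta> S T where
  collapse_Nil: "collapse_word \<beta> S T p [] [] p"
| collapse_Cons: "collapse \<beta> S T p a o' q \<Longrightarrow> collapse_word \<beta> S T q w w' r \<Longrightarrow>
    collapse_word \<beta> S T p (a # w) (cons_option o' w') r"

lemma collapse_output: "collapse \<beta> S T p a o' q \<Longrightarrow> o' = None \<or> o' = Some a"
  by (auto elim: collapse.cases)

lemma collapse_word_subset: "collapse_word \<beta> S T p w w' q \<Longrightarrow> set w' \<subseteq> set w"
proof (induction rule: collapse_word.induct)
  case (collapse_Cons p a o' q w w' r)
  then show ?case using collapse_output[OF collapse_Cons(1)] by auto
qed simp

text \<open>The power \<open>\<beta>\<^sup>p\<close> whose exponent is the truth value \<open>p\<close>, read as 0 or 1.\<close>

definition letter_if :: "'a letter \<Rightarrow> bool \<Rightarrow> 'a word" where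
  "letter_if \<beta> p = (if p then [\<beta>] else [])"

definition whitehead :: "'a letter \<Rightarrow> 'a set \<Rightarrow> 'a set \<Rightarrow> 'a \<Rightarrow> 'a word" where
  "whitehead \<beta> S T x =
    (if x = fst \<beta> then [(x, True)]
     else letter_if \<beta> (x \<in> S) @ [(x, True)] @ inv_word (letter_if \<beta> (x \<in> T)))"

text \<open>
  A Whitehead substitution fixes the generator of \<open>\<beta>\<close>, hence the factors \<open>\<beta>\<^sup>p\<close> in the images
  of the other generators. So inverting these factors gives the inverse automorphism.
\<close>

lemma lift_own_generator:
  "\<sigma> (fst \<beta>) = [(fst \<beta>, True)] \<Longrightarrow> lift \<sigma> (letter_if \<beta> p) = letter_if \<beta> p"
  by (cases \<beta>) (auto simp: letter_if_def inv_letter_def)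

lemma automorphism_whitehead:
  assumes "\<beta> \<in> X \<times> UNIV"
  shows "automorphism_words X (whitehead \<beta> S T)"
proof -
  define \<tau> where "\<tau> x =
    (if x = fst \<beta> then [(x, True)]
     else inv_word (letter_if \<beta> (x \<in> S)) @ [(x, True)] @ letter_if \<beta> (x \<in> T))" for x
  have own: "whitehead \<beta> S T (fst \<beta>) = [(fst \<beta>, True)]" "\<tau> (fst \<beta>) = [(fst \<beta>, True)]"
    by (simp_all add: whitehead_def \<tau>_def)
  note lifts = lift_own_generator[of "whitehead \<beta> S T", OF own(1)] lift_own_generator[of \<tau>, OF own(2)]
  have "lift \<tau> (whitehead \<beta> S T x) \<sim> [(x, True)]" for x
  proof (cases "x = fst \<beta>")
    case True
    then show ?thesis using own by simp
  next
    case False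
    let ?s = "letter_if \<beta> (x \<in> S)" and ?t = "letter_if \<beta> (x \<in> T)"
    have "lift \<tau> (whitehead \<beta> S T x) = ?s @ inv_word ?s @ [(x, True)] @ ?t @ inv_word ?t"
      using False by (simp add: whitehead_def lifts) (simp add: \<tau>_def)
    also have "\<dots> \<sim> [(x, True)] @ ?t @ inv_word ?t"
      by simp
    also have "[(x, True)] @ ?t @ inv_word ?t \<sim> [(x, True)] @ []"
      by (intro free_eq_append) simp_all
    finally show ?thesis by simp
  qed
  moreover have "lift (whitehead \<beta> S T) (\<tau> x) \<sim> [(x, True)]" for x
  proof (cases "x = fst \<beta>")
    case True
    then show ?thesis using own by simp
  next
    case False
    let ?s = "letter_if \<beta> (x \<in> S)" and ?t = "letter_if \<beta> (x \<in> T)"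
    have "lift (whitehead \<beta> S T) (\<tau> x) = inv_word ?s @ ?s @ [(x, True)] @ inv_word ?t @ ?t"
      using False by (simp add: \<tau>_def lifts) (simp add: whitehead_def)
    also have "\<dots> \<sim> [(x, True)] @ inv_word ?t @ ?t"
      by simp
    also have "[(x, True)] @ inv_word ?t @ ?t \<sim> [(x, True)] @ []"
      by (intro free_eq_append) simp_all
    finally show ?thesis by simp
  qed
  moreover have "whitehead \<beta> S T x \<in> lists (X \<times> UNIV)" "\<tau> x \<in> lists (X \<times> UNIV)" if "x \<in> X" for x
    using that assms by (auto simp: whitehead_def \<tau>_def letter_if_def inv_letter_def)
  ultimately show ?thesis
    unfolding automorphism_words_def by blast
qed

text \<open>
  Applying the Whitehead automorphism to the output gives back the input: on every single
  edge from \<open>p\<close> to \<open>q\<close>, it gives the label \<open>a\<close> as \<open>\<beta>\<^sup>p a \<beta>\<^sup>-\<^sup>q\<close>, and these factors cancel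
  along a walk.
\<close>

lemma lift_whitehead_collapse:
  assumes "collapse \<beta> S T p a o' q"
  shows "lift (whitehead \<beta> S T) (cons_option o' []) \<sim>
    letter_if \<beta> p @ [a] @ inv_word (letter_if \<beta> q)"
  using assms
proof cases
  case loop
  have "a = \<beta> \<or> a = inv_letter \<beta>"
    using loop by (auto simp: inv_letter_def prod_eq_iff)
  moreover have "[\<beta>, \<beta>, inv_letter \<beta>] \<sim> [\<beta>]" "[\<beta>, inv_letter \<beta>, inv_letter \<beta>] \<sim> [inv_letter \<beta>]"
    by (simp_all add: free_reduce_def)
  moreover have "lift (whitehead \<beta> S T) [a] = [a]"
    using loop by (cases a) (auto simp: whitehead_def inv_letter_def)
  ultimately show ?thesis
    using loop by (auto simp: letter_if_def)
qed (simp_all add: whitehead_def letter_if_def inv_letter_def free_reduce_def)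

lemma lift_whitehead_collapse_word:
  "collapse_word \<beta> S T p w w' q \<Longrightarrow>
    lift (whitehead \<beta> S T) w' \<sim> letter_if \<beta> p @ w @ inv_word (letter_if \<beta> q)"
proof (induction rule: collapse_word.induct)
  case (collapse_Nil p)
  then show ?case by simp
next
  case (collapse_Cons p a o' q w w' r)
  let ?\<theta> = "whitehead \<beta> S T" and ?b = "letter_if \<beta>"
  have "lift ?\<theta> (cons_option o' w') = lift ?\<theta> (cons_option o' []) @ lift ?\<theta> w'"
    by (cases o') auto
  also have "\<dots> \<sim> (?b p @ [a] @ inv_word (?b q)) @ (?b q @ w @ inv_word (?b r))"
    using lift_whitehead_collapse[OF collapse_Cons(1)] collapse_Cons.IH by (rule free_eq_append)
  also have "(?b p @ [a] @ inv_word (?b q)) @ (?b q @ w @ inv_word (?b r)) =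
      (?b p @ [a]) @ (inv_word (?b q) @ ?b q @ w @ inv_word (?b r))"
    by simp
  also have "\<dots> \<sim> (?b p @ [a]) @ (w @ inv_word (?b r))"
    by (rule free_eq_append) simp_all
  finally show ?case by simp
qed

lemma free_eq_lift_whitehead:
  "collapse_word \<beta> S T False w w' False \<Longrightarrow> w \<sim> lift (whitehead \<beta> S T) w'"
  using lift_whitehead_collapse_word[of \<beta> S T False w w' False] by (simp add: letter_if_def)

text \<open>
  A graph with two vertices and one edge more than generators, in which every generator
  occurs and some letter \<open>\<beta>\<close> leads from one vertex to both: all other generators have
  just one edge. Up to inverting \<open>\<beta>\<close>, the edge that is not a loop starts at the base point.
\<close>

lemma two_vertices_collapse:
  assumes X: "finite X" and petals: "petals X v ps"
    and two: "card (vertices v ps) = 2" "card (edge ` steps ps) \<le> Suc (card X)"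
    and letters: "\<forall>x \<in> X. \<exists>s \<in> steps ps. x = fst (fst (snd s))"
    and fork: "edge (p, \<beta>, q) \<in> edge ` steps ps" "edge (p, \<beta>, r) \<in> edge ` steps ps" "q \<noteq> r"
  shows "\<exists>\<beta> S T. \<beta> \<in> X \<times> UNIV \<and> S \<subseteq> X \<and> T \<subseteq> X \<and>
    (\<forall>(p, a, q) \<in> steps ps. \<exists>o'. collapse \<beta> S T (p \<noteq> v) a o' (q \<noteq> v)) \<and>
    (\<exists>(p, a, q) \<in> steps ps. collapse \<beta> S T (p \<noteq> v) a None (q \<noteq> v))"
proof -
  let ?E = "edge ` steps ps" and ?b = "fst \<beta>"
  have in_X: "fst a \<in> X" if step: "(p, a, q) \<in> steps ps" for p a q
  proof -
    obtain \<pi> where \<pi>: "\<pi> \<in> set ps" "(p, a, q) \<in> set \<pi>"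
      using step unfolding steps_def by blast
    have "a = fst (snd (p, a, q))" by simp
    then have "a \<in> set (label \<pi>)" using \<pi>(2) unfolding set_map by (rule image_eqI)
    moreover have "set (label \<pi>) \<subseteq> X \<times> UNIV"
      using petals \<pi>(1) unfolding petals_def lists_eq_set by blast
    ultimately show ?thesis by (auto simp: mem_Times_iff)
  qed
  have p: "p \<in> vertices v ps" and "q \<in> vertices v ps" "r \<in> vertices v ps"
    using edge_vertices[OF fork(1), of v] edge_vertices[OF fork(2), of v] by simp_all
  then have V: "{q, r} = vertices v ps"
    using two(1) fork(3) by (intro card_subset_eq) simp_all
  moreover have "v \<in> vertices v ps" by (simp add: vertices_def)
  ultimately have "p \<in> {q, r}" "v \<in> {q, r}" using p by simp_all
  define u where "u = (if p = q then r else q)"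
  have fork': "edge (p, \<beta>, p) \<in> ?E" "edge (p, \<beta>, u) \<in> ?E" "u \<noteq> p" "v = p \<or> v = u"
    using fork \<open>p \<in> {q, r}\<close> \<open>v \<in> {q, r}\<close> by (auto simp: u_def)
  obtain s where "s \<in> steps ps" "edge s = edge (p, \<beta>, u)"
    using fork'(2) by auto
  then have "(p, \<beta>, u) \<in> steps ps \<or> (u, inv_letter \<beta>, p) \<in> steps ps"
    using edge_eq_cases[of s p \<beta> u] by auto
  then have b: "?b \<in> X"
    using in_X[of p \<beta> u] in_X[of u "inv_letter \<beta>" p] by auto
  have "\<exists>e. e \<in> ?E \<and> fst (snd e) = x" if x: "x \<in> X" for x
  proof -
    obtain p a q where "(p, a, q) \<in> steps ps" "x = fst a"
      using letters x by force
    then show ?thesis using edge_letter[of p a q] by blast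
  qed
  then obtain g where g: "\<And>x. x \<in> X \<Longrightarrow> g x \<in> ?E \<and> fst (snd (g x)) = x"
    by metis
  define E' where "E' = insert (edge (p, \<beta>, p)) (insert (edge (p, \<beta>, u)) (g ` (X - {?b})))"
  have "E' \<subseteq> ?E" using g fork' by (auto simp: E'_def)
  moreover have "card E' = Suc (card X)"
  proof -
    have "inj_on g (X - {?b})" using g by (metis Diff_iff inj_onI)
    then have "card (g ` (X - {?b})) = card X - 1"
      using X b by (simp add: card_image)
    moreover have "edge (p, \<beta>, w) \<notin> g ` (X - {?b})" for w
      using g edge_letter[of p \<beta> w] by auto
    moreover have "edge (p, \<beta>, p) \<noteq> edge (p, \<beta>, u)"
      using fork'(3) by (cases \<beta>) auto
    moreover have "card X > 0" using X b by (auto simp: card_gt_0_iff)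
    ultimately show ?thesis using X by (simp add: E'_def)
  qed
  ultimately have E: "?E = E'"
    using two(2) by (metis card_seteq finite_imageI finite_steps)
  \<comment> \<open>The letter whose edge leads away from the base point.\<close>
  define \<gamma> where "\<gamma> = (if v = p then \<beta> else inv_letter \<beta>)"
  define S where "S = {x \<in> X. fst (g x) \<noteq> v}"
  define T where "T = {x \<in> X. snd (snd (g x)) \<noteq> v}"
  have \<gamma>: "fst \<gamma> = ?b" by (simp add: \<gamma>_def)
  have deleted: "collapse \<gamma> S T (p' \<noteq> v) a None (q' \<noteq> v)"
    if eq: "edge (p', a, q') = edge (p, \<beta>, u)" for p' a q'
  proof -
    consider "p' = p" "a = \<beta>" "q' = u" | "p' = u" "a = inv_letter \<beta>" "q' = p"
      using edge_eq_cases[OF eq] by auto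
    then show ?thesis
      using fork'(3,4) delete[of \<gamma> S T] delete_inv[of \<gamma> S T]
      by cases (auto simp: \<gamma>_def)
  qed
  have "\<exists>o'. collapse \<gamma> S T (p' \<noteq> v) a o' (q' \<noteq> v)" if step: "(p', a, q') \<in> steps ps" for p' a q'
  proof -
    have "edge (p', a, q') \<in> E'" using step E by blast
    then consider "edge (p', a, q') = edge (p, \<beta>, p)" | "edge (p', a, q') = edge (p, \<beta>, u)"
      | x where "x \<in> X" "x \<noteq> ?b" "edge (p', a, q') = g x"
      unfolding E'_def by blast
    then show ?thesis
    proof cases
      case 1
      then have "p' = p" "q' = p" "fst a = ?b"
        using edge_eq_cases[OF 1] by auto
      then show ?thesis using loop[of a \<gamma> S T] \<gamma> by auto
    next
      case 2
      then show ?thesis using deleted by blast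
    next
      case (3 x)
      have a: "fst a = x" using g[OF 3(1)] 3(3) edge_letter[of p' a q'] by simp
      show ?thesis
      proof (cases "snd a")
        case True
        then have "a = (x, True)" "g x = (p', x, q')"
          using a 3 by (cases a; simp)+
        then show ?thesis
          using along[of x \<gamma> S T] 3 \<gamma> by (auto simp: S_def T_def)
      next
        case False
        then have "a = (x, False)" "g x = (q', x, p')"
          using a 3 by (cases a; simp)+
        then show ?thesis
          using against[of x \<gamma> S T] 3 \<gamma> by (auto simp: S_def T_def)
      qed
    qed
  qed
  then have all: "\<forall>(p, a, q) \<in> steps ps. \<exists>o'. collapse \<gamma> S T (p \<noteq> v) a o' (q \<noteq> v)"
    by (intro ballI) (simp add: case_prod_beta)
  obtain p' a q' where "(p', a, q') \<in> steps ps" "edge (p', a, q') = edge (p, \<beta>, u)"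
    using \<open>s \<in> steps ps\<close> \<open>edge s = edge (p, \<beta>, u)\<close> by (cases s) blast
  then have some: "\<exists>(p, a, q) \<in> steps ps. collapse \<gamma> S T (p \<noteq> v) a None (q \<noteq> v)"
    using deleted[of p' a q'] by (intro bexI[of _ "(p', a, q')"]) simp_all
  have "\<gamma> \<in> X \<times> UNIV" "S \<subseteq> X" "T \<subseteq> X"
    using \<gamma> b by (simp_all add: mem_Times_iff S_def T_def)
  with all some show ?thesis by blast
qed

lemma walk_collapse_word:
  assumes "walk p \<pi> q" "\<forall>(p, a, q) \<in> set \<pi>. \<exists>o'. collapse \<beta> S T (h p) a o' (h q)"
  shows "\<exists>w'. collapse_word \<beta> S T (h p) (label \<pi>) w' (h q) \<and> length w' \<le> length \<pi> \<and>
    ((\<exists>(p, a, q) \<in> set \<pi>. collapse \<beta> S T (h p) a None (h q)) \<longrightarrow> length w' < length \<pi>)"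
  using assms
proof (induction \<pi> arbitrary: p)
  case Nil
  then show ?case by (auto intro: collapse_Nil)
next
  case (Cons s \<pi>)
  obtain a r where s: "s = (p, a, r)" "walk r \<pi> q"
    using Cons.prems by (cases s) auto
  obtain w' where w': "collapse_word \<beta> S T (h r) (label \<pi>) w' (h q)" "length w' \<le> length \<pi>"
      "(\<exists>(p, a, q) \<in> set \<pi>. collapse \<beta> S T (h p) a None (h q)) \<longrightarrow> length w' < length \<pi>"
    using Cons.IH[OF s(2)] Cons.prems(2) by auto
  \<comment> \<open>The letter is deleted whenever this is possible.\<close>
  obtain o' where o': "collapse \<beta> S T (h p) a o' (h r)"
      "collapse \<beta> S T (h p) a None (h r) \<longrightarrow> o' = None"
    using Cons.prems(2) s by auto
  have "collapse_word \<beta> S T (h p) (label (s # \<pi>)) (cons_option o' w') (h q)"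
    using collapse_Cons[OF o'(1) w'(1)] s by simp
  then show ?case
    using w'(2,3) o'(2) s by (intro exI[of _ "cons_option o' w'"]) (cases o'; auto)
qed

text \<open>
  Fold the subdivided rose of a generating family until two vertices are left; one more
  fold would give the bouquet of circles. Collapsing instead the edge that this fold would
  make a loop is a change of basis. Words are shortened by the number of times that
  their petals cross this edge, and as each edge lies on some petal, at least one of them
  gets shorter.
\<close>

theorem generating_collapse:
  assumes "finite X" "set bs \<subseteq> lists (X \<times> UNIV)" "generating X (set bs)" "length bs \<le> card X"
    and "\<exists>b \<in> set bs. length b \<ge> 2"
  shows "\<exists>\<beta> S T bs'. \<beta> \<in> X \<times> UNIV \<and> S \<subseteq> X \<and> T \<subseteq> X \<and>
    list_all2 (\<lambda>b b'. collapse_word \<beta> S T False b b' False) bs bs' \<and>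
    length (concat bs') < length (concat bs)"
proof -
  obtain v0 :: "nat \<times> nat" and ps0 where "petals X v0 ps0" "map label ps0 = bs"
      "card (edge ` steps ps0) + 1 \<le> card (vertices v0 ps0) + length bs"
      "card (vertices v0 ps0) \<ge> 2"
    using subdivided_rose[OF assms(2)] assms(5) by blast
  then have "\<exists>(v :: nat \<times> nat) ps. petals X v ps \<and> map label ps = map label ps0 \<and>
      card (vertices v ps) = 2 \<and> card (edge ` steps ps) \<le> Suc (length bs)"
    using assms(3) by (intro fold_to_two_vertices) auto
  with \<open>map label ps0 = bs\<close> obtain v :: "nat \<times> nat" and ps where ps: "petals X v ps"
      "map label ps = bs" "card (vertices v ps) = 2" "card (edge ` steps ps) \<le> Suc (length bs)"
    by auto
  have "\<not> folded (edge ` steps ps)"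
  proof
    assume "folded (edge ` steps ps)"
    then have "vertices v ps = {v}"
      using ps assms(3) by (intro folded_generating_one_vertex) auto
    then show False using ps(3) by simp
  qed
  then obtain p \<beta> q r where fork:
    "edge (p, \<beta>, q) \<in> edge ` steps ps" "edge (p, \<beta>, r) \<in> edge ` steps ps" "q \<noteq> r"
    unfolding folded_def by blast
  have letters: "\<forall>x \<in> X. \<exists>s \<in> steps ps. x = fst (fst (snd s))"
  proof
    fix x assume x: "x \<in> X"
    have "\<exists>b \<in> label ` set ps. x \<in> fst ` set b"
      using generating_letters[OF assms(3) x] ps(2) by (metis set_map)
    then obtain \<pi> s where "\<pi> \<in> set ps" "s \<in> set \<pi>" "x = fst (fst (snd s))" by auto
    then show "\<exists>s \<in> steps ps. x = fst (fst (snd s))" unfolding steps_def by blast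
  qed
  have "card (edge ` steps ps) \<le> Suc (card X)"
    using ps(4) assms(4) by simp
  from two_vertices_collapse[OF assms(1) ps(1,3) this letters fork]
  obtain \<beta> S T where \<beta>: "\<beta> \<in> X \<times> UNIV" "S \<subseteq> X" "T \<subseteq> X"
      "\<forall>(p, a, q) \<in> steps ps. \<exists>o'. collapse \<beta> S T (p \<noteq> v) a o' (q \<noteq> v)"
      "\<exists>(p, a, q) \<in> steps ps. collapse \<beta> S T (p \<noteq> v) a None (q \<noteq> v)"
    by (elim exE conjE) (rule that)
  let ?shorter = "\<lambda>\<pi>. \<exists>(p, a, q) \<in> set \<pi>. collapse \<beta> S T (p \<noteq> v) a None (q \<noteq> v)"
  have "\<forall>\<pi> \<in> set ps. \<exists>w'. collapse_word \<beta> S T False (label \<pi>) w' False \<and>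
      length w' \<le> length \<pi> \<and> (?shorter \<pi> \<longrightarrow> length w' < length \<pi>)"
  proof
    fix \<pi> assume \<pi>: "\<pi> \<in> set ps"
    then have "\<forall>(p, a, q) \<in> set \<pi>. \<exists>o'. collapse \<beta> S T (p \<noteq> v) a o' (q \<noteq> v)" "walk v \<pi> v"
      using \<beta>(4) ps(1) by (auto simp: steps_def petals_def)
    from walk_collapse_word[OF this(2), of \<beta> S T "\<lambda>p. p \<noteq> v", OF this(1)]
    show "\<exists>w'. collapse_word \<beta> S T False (label \<pi>) w' False \<and>
        length w' \<le> length \<pi> \<and> (?shorter \<pi> \<longrightarrow> length w' < length \<pi>)"
      by simp
  qed
  then obtain f where f: "\<forall>\<pi> \<in> set ps. collapse_word \<beta> S T False (label \<pi>) (f \<pi>) False \<and>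
      length (f \<pi>) \<le> length \<pi> \<and> (?shorter \<pi> \<longrightarrow> length (f \<pi>) < length \<pi>)"
    by metis
  let ?bs' = "map f ps"
  have "list_all2 (\<lambda>b b'. collapse_word \<beta> S T False b b' False) bs ?bs'"
    using f unfolding ps(2)[symmetric] by (simp add: list_all2_conv_all_nth)
  moreover have "length (concat ?bs') < length (concat bs)"
  proof -
    obtain \<pi> where \<pi>: "\<pi> \<in> set ps" "?shorter \<pi>"
      using \<beta>(5) unfolding steps_def by blast
    have le: "sum_list (map (\<lambda>\<pi>. length (f \<pi>)) qs) \<le> sum_list (map length qs)" if "set qs \<subseteq> set ps" for qs
      using that f by (intro sum_list_mono) auto
    obtain qs rs where qs: "ps = qs @ \<pi> # rs" using \<pi>(1) by (auto simp: in_set_conv_decomp)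
    have "length (f \<pi>) < length \<pi>" using f \<pi> by blast
    moreover have "sum_list (map (\<lambda>\<pi>. length (f \<pi>)) qs) \<le> sum_list (map length qs)"
        "sum_list (map (\<lambda>\<pi>. length (f \<pi>)) rs) \<le> sum_list (map length rs)"
      using qs by (auto intro!: le)
    ultimately show ?thesis
      unfolding ps(2)[symmetric] length_concat
      by (simp add: qs comp_def)
  qed
  ultimately show ?thesis using \<beta>(1-3) by blast
qed


section \<open>The rank of a free group\<close>

definition parity :: "'a set \<Rightarrow> 'a word \<Rightarrow> bool" where
  "parity S w \<longleftrightarrow> odd (length (filter (\<lambda>a. fst a \<in> S) w))"

lemma parity_simps [simp]:
  "\<not> parity S []"
  "parity S (a # w) \<longleftrightarrow> (fst a \<in> S) \<noteq> parity S w"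
  "parity S (u @ v) \<longleftrightarrow> parity S u \<noteq> parity S v"
  by (auto simp: parity_def)

lemma parity_inv_word [simp]: "parity S (inv_word w) = parity S w"
  by (induction w) auto

lemma parity_push: "parity S (push a w) = parity S (a # w)"
  by (cases w) auto

lemma parity_free_reduce: "parity S (free_reduce w) = parity S w"
proof (induction w)
  case (Cons a w)
  then show ?case
    using parity_push[of S a "free_reduce w"] by (simp add: free_reduce_def)
qed simp

lemma parity_lift: "parity S (lift \<sigma> w) = parity {x. parity S (\<sigma> x)} w"
  by (induction w) auto

lemma parity_restrict: "w \<in> lists (X \<times> UNIV) \<Longrightarrow> parity (S \<inter> X) w = parity S w"
  by (induction w) auto

text \<open>
  The homomorphisms from a free group to the group with two elements correspond to the
  subsets of any basis. Their number does not depend on the basis.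
\<close>

lemma card_free_basis:
  assumes "finite X" "free_basis (free_group X) B"
  shows "finite B" "card B \<le> card X"
proof -
  let ?F = "free_group X" and ?FB = "free_group B"
  have B: "B \<subseteq> carrier ?F" and iso: "word_eval ?F \<in> iso ?FB ?F"
    using assms(2) by (auto simp: free_basis_def)
  note eval = word_eval_free_group[OF B]
  have inj: "inj_on (word_eval ?F) (carrier ?FB)" and onto: "word_eval ?F ` carrier ?FB = carrier ?F"
    using iso by (auto simp: iso_def bij_betw_def)
  have "\<exists>u. u \<in> carrier ?FB \<and> word_eval ?F u = [(x, True)]" if "x \<in> X" for x
  proof -
    have "[(x, True)] \<in> carrier ?F"
      using that by (simp add: carrier_free_group reduced_Cons)
    then have "[(x, True)] \<in> word_eval ?F ` carrier ?FB" by (simp add: onto)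
    then show ?thesis by (elim imageE) auto
  qed
  then obtain \<iota> where \<iota>: "\<And>x. x \<in> X \<Longrightarrow> \<iota> x \<in> carrier ?FB \<and> word_eval ?F (\<iota> x) = [(x, True)]"
    by metis
  have lists_B: "\<iota> x \<in> lists (B \<times> UNIV)" if "x \<in> X" for x
    using \<iota>[OF that] unfolding carrier_free_group by simp
  have "lift (\<lambda>w. w) (\<iota> x) \<sim> [(x, True)]" if "x \<in> X" for x
    using \<iota>[OF that] eval[OF lists_B[OF that]] by (simp add: free_reduce_def)
  then have inverse: "lift (\<lambda>w. w) (lift \<iota> w) \<sim> w" if "w \<in> lists (X \<times> UNIV)" for w
    using that by (intro lift_lift_inverse[of X]) blast+
  have coordinates: "lift \<iota> b \<sim> [(b, True)]" if "b \<in> B" for b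
  proof -
    have b: "b \<in> lists (X \<times> UNIV)" "reduced b"
      using subsetD[OF B that] unfolding carrier_free_group by simp_all
    have u: "free_reduce (lift \<iota> b) \<in> lists (B \<times> UNIV)"
      using b(1) lists_B by (intro free_reduce_in_lists lift_in_lists)
    have "word_eval ?F (free_reduce (lift \<iota> b)) = b"
      unfolding eval[OF u] using inverse[OF b(1)] b(2)
      by (simp add: lift_free_reduce free_reduce_id)
    also have "b = word_eval ?F [(b, True)]"
      using eval[of "[(b, True)]"] that b(2) by (simp add: free_reduce_id)
    finally have "free_reduce (lift \<iota> b) = [(b, True)]"
      using u that by (intro inj_onD[OF inj]) (simp_all add: carrier_free_group reduced_Cons)
    then show ?thesis by (simp add: free_reduce_def)
  qed
  \<comment> \<open>The homomorphism that is 1 exactly on the basis elements in \<open>S\<close> is 1 exactly on the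
    generators in \<open>?P S\<close>.\<close>
  let ?P = "\<lambda>S. {x. parity S (\<iota> x)} \<inter> X"
  have member: "b \<in> S \<longleftrightarrow> parity (?P S) b" if "b \<in> B" for b S
  proof -
    have b: "b \<in> lists (X \<times> UNIV)"
      using subsetD[OF B that] unfolding carrier_free_group by simp
    have "b \<in> S \<longleftrightarrow> parity S [(b, True)]" by simp
    also have "\<dots> \<longleftrightarrow> parity S (lift \<iota> b)"
      using coordinates[OF that] parity_free_reduce by metis
    also have "\<dots> \<longleftrightarrow> parity (?P S) b"
      unfolding parity_lift parity_restrict[OF b] ..
    finally show ?thesis .
  qed
  have inj_P: "inj_on ?P (Pow B)"
  proof (rule inj_onI)
    fix S S' assume S: "S \<in> Pow B" "S' \<in> Pow B" and eq: "?P S = ?P S'"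
    have "b \<in> S \<longleftrightarrow> b \<in> S'" if "b \<in> B" for b
      unfolding member[OF that, of S] member[OF that, of S'] eq ..
    with S show "S = S'" by blast
  qed
  have "?P ` Pow B \<subseteq> Pow X" by blast
  then have "finite (Pow B)" "card (Pow B) \<le> card (Pow X)"
    using inj_on_finite[OF inj_P] card_inj_on_le[OF inj_P] assms(1) by simp_all
  then show "finite B" "card B \<le> card X"
    using assms(1) by (simp_all add: card_Pow)
qed

lemma generating_free_basis:
  assumes "free_basis (free_group X) B"
  shows "generating X B"
  unfolding generating_def
proof
  let ?F = "free_group X" and ?FB = "free_group B"
  fix w :: "'a word" assume w: "w \<in> lists (X \<times> UNIV)"
  have B: "B \<subseteq> carrier ?F" and "word_eval ?F ` carrier ?FB = carrier ?F"
    using assms by (auto simp: free_basis_def iso_def bij_betw_def)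
  moreover have "free_reduce w \<in> carrier ?F"
    using free_reduce_in_lists[OF w] by (simp add: carrier_free_group del: in_lists_conv_set)
  ultimately obtain u where u: "u \<in> carrier ?FB" "word_eval ?F u = free_reduce w"
    by (metis imageE)
  have u_in: "u \<in> lists (B \<times> UNIV)" using u(1) unfolding carrier_free_group by blast
  have "lift (\<lambda>w. w) u \<sim> w"
    using u(2) word_eval_free_group[OF B u_in] by simp
  with generates_lift[OF u_in] show "generates B w" by (rule generates_eq)
qed


section \<open>Linearly bounded automata that sweep their tape\<close>

inductive run :: "('q \<times> 'c \<times> 'c \<times> 'q) set \<Rightarrow> 'q \<Rightarrow> 'c list \<Rightarrow> 'c list \<Rightarrow> 'q \<Rightarrow> bool"
  for \<delta> where
  run_Nil: "run \<delta> q [] [] q"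
| run_Cons: "(q, a, b, q1) \<in> \<delta> \<Longrightarrow> run \<delta> q1 t t' q2 \<Longrightarrow> run \<delta> q (a # t) (b # t') q2"

lemma run_Cons_iff:
  "run \<delta> q (a # t) u r \<longleftrightarrow> (\<exists>b q1 u'. u = b # u' \<and> (q, a, b, q1) \<in> \<delta> \<and> run \<delta> q1 t u' r)"
  by (subst run.simps) auto

lemma run_append: "run \<delta> q t t' q1 \<Longrightarrow> run \<delta> q1 u u' q2 \<Longrightarrow> run \<delta> q (t @ u) (t' @ u') q2"
  by (induction rule: run.induct) (auto intro: run.intros)

lemma run_length: "run \<delta> q t t' q' \<Longrightarrow> length t' = length t"
  by (induction rule: run.induct) auto

lemma run_in_lists:
  "run \<delta> q t t' q' \<Longrightarrow> \<delta> \<subseteq> Q \<times> \<Gamma> \<times> \<Gamma> \<times> Q \<Longrightarrow> t \<in> lists \<Gamma> \<and> t' \<in> lists \<Gamma>"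
  by (induction rule: run.induct) auto

lemma run_map_states:
  "run \<delta> q t t' q' \<Longrightarrow> run ((\<lambda>(p, a, b, p'). (f p, a, b, f p')) ` \<delta>) (f q) t t' (f q')"
proof (induction rule: run.induct)
  case (run_Nil q)
  show ?case by (rule run.run_Nil)
next
  case (run_Cons q a b q1 t t' q2)
  then have "(f q, a, b, f q1) \<in> (\<lambda>(p, a, b, p'). (f p, a, b, f p')) ` \<delta>"
    by (auto intro: rev_image_eqI)
  then show ?case using run_Cons.IH by (rule run.run_Cons)
qed

lemma run_map_states_inj:
  assumes "run ((\<lambda>(p, a, b, p'). (f p, a, b, f p')) ` \<delta>) r t t' r'"
    and "inj_on f Q" "\<delta> \<subseteq> Q \<times> \<Gamma> \<times> \<Gamma> \<times> Q" "r = f q" "r' = f q'" "q \<in> Q" "q' \<in> Q"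
  shows "run \<delta> q t t' q'"
  using assms
proof (induction arbitrary: q rule: run.induct)
  case (run_Nil r)
  then have "q = q'" by (auto simp: inj_on_def)
  then show ?case by (simp add: run.run_Nil)
next
  case (run_Cons r a b r1 t t' r2)
  then obtain p p1 where p: "(p, a, b, p1) \<in> \<delta>" "r = f p" "r1 = f p1" by auto
  then have "p \<in> Q" "p1 \<in> Q" using run_Cons.prems by auto
  then have "p = q" using p run_Cons.prems by (auto simp: inj_on_def)
  then show ?case
    using p \<open>p1 \<in> Q\<close> run_Cons by (intro run.run_Cons[of q a b p1]) auto
qed

text \<open>
  The cells of the tape hold the symbols of \<open>\<Sigma>\<close> and a blank \<open>None\<close>. Numbering the states
  lets transducers with different types of states be combined in one machine.
\<close>

definition cells :: "'s set \<Rightarrow> 's option set" where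
  "cells \<Sigma> = insert None (Some ` \<Sigma>)"

definition finite_state_relation ::
    "'s set \<Rightarrow> ('s option list \<Rightarrow> 's option list \<Rightarrow> bool) \<Rightarrow> bool" where
  "finite_state_relation \<Sigma> R \<longleftrightarrow>
    (\<exists>(Q :: nat set) \<delta> I F. finite Q \<and> \<delta> \<subseteq> Q \<times> cells \<Sigma> \<times> cells \<Sigma> \<times> Q \<and> I \<subseteq> Q \<and> F \<subseteq> Q \<and>
      R = (\<lambda>t t'. \<exists>q \<in> I. \<exists>q' \<in> F. run \<delta> q t t' q'))"

lemma finite_state_relationI:
  fixes Q :: "'q set"
  assumes "finite Q" "\<delta> \<subseteq> Q \<times> cells \<Sigma> \<times> cells \<Sigma> \<times> Q" "I \<subseteq> Q" "F \<subseteq> Q"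
  shows "finite_state_relation \<Sigma> (\<lambda>t t'. \<exists>q \<in> I. \<exists>q' \<in> F. run \<delta> q t t' q')"
proof -
  obtain f :: "'q \<Rightarrow> nat" where f: "inj_on f Q"
    using finite_imp_inj_to_nat_seg[OF assms(1)] by blast
  let ?\<delta> = "(\<lambda>(p, a, b, p'). (f p, a, b, f p')) ` \<delta>"
  have "(\<exists>q \<in> I. \<exists>q' \<in> F. run \<delta> q t t' q') \<longleftrightarrow>
      (\<exists>q \<in> f ` I. \<exists>q' \<in> f ` F. run ?\<delta> q t t' q')" for t t'
  proof
    assume "\<exists>q \<in> I. \<exists>q' \<in> F. run \<delta> q t t' q'"
    then obtain q q' where q: "q \<in> I" "q' \<in> F" "run \<delta> q t t' q'" by auto
    then show "\<exists>q \<in> f ` I. \<exists>q' \<in> f ` F. run ?\<delta> q t t' q'"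
      using run_map_states[OF q(3), of f] by blast
  next
    assume "\<exists>q \<in> f ` I. \<exists>q' \<in> f ` F. run ?\<delta> q t t' q'"
    then obtain q q' where q: "q \<in> I" "q' \<in> F" "run ?\<delta> (f q) t t' (f q')"
      by (elim bexE imageE) simp
    then have "run \<delta> q t t' q'"
      using assms(3,4) by (intro run_map_states_inj[OF q(3) f assms(2)]) auto
    then show "\<exists>q \<in> I. \<exists>q' \<in> F. run \<delta> q t t' q'" using q(1,2) by (intro bexI)
  qed
  then have "(\<lambda>t t'. \<exists>q \<in> I. \<exists>q' \<in> F. run \<delta> q t t' q') =
      (\<lambda>t t'. \<exists>q \<in> f ` I. \<exists>q' \<in> f ` F. run ?\<delta> q t t' q')"
    by (intro ext)
  moreover have "finite (f ` Q)" "f ` I \<subseteq> f ` Q" "f ` F \<subseteq> f ` Q"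
      "?\<delta> \<subseteq> f ` Q \<times> cells \<Sigma> \<times> cells \<Sigma> \<times> f ` Q"
    using assms by auto
  ultimately show ?thesis
    unfolding finite_state_relation_def
    by (intro exI[of _ "f ` Q"] exI[of _ ?\<delta>] exI[of _ "f ` I"] exI[of _ "f ` F"] conjI)
qed

fun cell :: "'s option \<Rightarrow> 's tape_symbol" where
  "cell None = Aux 0"
| "cell (Some s) = Input s"

lemma cell_neq [simp]: "cell c \<noteq> LEnd" "cell c \<noteq> REnd" "LEnd \<noteq> cell c" "REnd \<noteq> cell c"
  by (cases c; simp)+

lemma cell_inj [simp]: "cell c = cell d \<longleftrightarrow> c = d"
  by (cases c; cases d) auto

definition tape :: "'s option list \<Rightarrow> 's tape_symbol list" where
  "tape t = LEnd # map cell t @ [REnd]"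

lemma length_tape [simp]: "length (tape t) = Suc (Suc (length t))"
  by (simp add: tape_def)

lemma tape_nth_0 [simp]: "tape t ! 0 = LEnd"
  by (simp add: tape_def)

lemma tape_nth_Suc: "i < length t \<Longrightarrow> tape t ! Suc i = cell (t ! i)"
  by (simp add: tape_def nth_append)

lemma tape_nth_end [simp]: "tape t ! Suc (length t) = REnd"
  by (simp add: tape_def nth_append)

lemma tape_nth_LEnd: "i < length (tape t) \<Longrightarrow> tape t ! i = LEnd \<Longrightarrow> i = 0"
  by (cases i) (auto simp: tape_def nth_append split: if_splits)

lemma tape_update: "i < length t \<Longrightarrow> (tape t)[Suc i := cell c] = tape (t[i := c])"
  by (simp add: tape_def list_update_append map_update)

lemma tape_update_same [simp]: "tape t ! i = b \<Longrightarrow> (tape t)[i := b] = tape t"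
  by auto

text \<open>
  The machine below runs a first transducer once, then a second one any number of times, and
  then a third one once. \<open>Begin\<close> and \<open>Repeat\<close> are the states at the left end, before
  and after the first sweep; \<open>Sweep j q\<close> is state \<open>q\<close> of transducer \<open>j\<close>; in the state \<open>Back\<close>
  the head returns to the left end.
\<close>

datatype sweep_state = Begin | Repeat | Sweep nat nat | Back | Accept

instance sweep_state :: countable
  by countable_datatype

inductive sweep_delta ::
    "'s set \<Rightarrow> (nat \<Rightarrow> (nat \<times> 's option \<times> 's option \<times> nat) set) \<Rightarrow> (nat \<Rightarrow> nat set) \<Rightarrow>
      (nat \<Rightarrow> nat set) \<Rightarrow> sweep_state \<Rightarrow> 's tape_symbol \<Rightarrow> sweep_state \<Rightarrow>
      's tape_symbol \<Rightarrow> direction \<Rightarrow> bool"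
  for \<Sigma> \<delta> I F where
  start: "q \<in> I 0 \<Longrightarrow> sweep_delta \<Sigma> \<delta> I F Begin LEnd (Sweep 0 q) LEnd MoveR"
| again: "j \<in> {1, 2} \<Longrightarrow> q \<in> I j \<Longrightarrow> sweep_delta \<Sigma> \<delta> I F Repeat LEnd (Sweep j q) LEnd MoveR"
| sweep: "j < 3 \<Longrightarrow> (q, a, b, q') \<in> \<delta> j \<Longrightarrow>
    sweep_delta \<Sigma> \<delta> I F (Sweep j q) (cell a) (Sweep j q') (cell b) MoveR"
| turn: "j \<in> {0, 1} \<Longrightarrow> q \<in> F j \<Longrightarrow> sweep_delta \<Sigma> \<delta> I F (Sweep j q) REnd Back REnd MoveL"
| accept: "q \<in> F 2 \<Longrightarrow> sweep_delta \<Sigma> \<delta> I F (Sweep 2 q) REnd Accept REnd Stay"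
| backward: "a \<in> cells \<Sigma> \<Longrightarrow> sweep_delta \<Sigma> \<delta> I F Back (cell a) Back (cell a) MoveL"
| left_end: "sweep_delta \<Sigma> \<delta> I F Back LEnd Repeat LEnd Stay"

definition sweep_lba ::
    "'s set \<Rightarrow> nat set \<Rightarrow> (nat \<Rightarrow> (nat \<times> 's option \<times> 's option \<times> nat) set) \<Rightarrow>
      (nat \<Rightarrow> nat set) \<Rightarrow> (nat \<Rightarrow> nat set) \<Rightarrow> 's lba" where
  "sweep_lba \<Sigma> Q \<delta> I F =
    \<lparr>states = to_nat ` ({Begin, Repeat, Back, Accept} \<union> (\<lambda>(j, q). Sweep j q) ` ({..<3} \<times> Q)),
     aux_symbols = {0},
     initial = to_nat Begin,
     accepting = {to_nat Accept},
     delta = {(to_nat p, a, to_nat p', b, d) | p a p' b d. sweep_delta \<Sigma> \<delta> I F p a p' b d}\<rparr>"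

lemma work_alphabet_sweep_lba: "work_alphabet \<Sigma> (sweep_lba \<Sigma> Q \<delta> I F) = cell ` cells \<Sigma>"
  by (simp add: work_alphabet_def sweep_lba_def cells_def image_image)

lemma is_lba_sweep_lba:
  assumes "finite \<Sigma>" "finite Q"
    and "\<And>j. j < 3 \<Longrightarrow> \<delta> j \<subseteq> Q \<times> cells \<Sigma> \<times> cells \<Sigma> \<times> Q"
    and "\<And>j. j < 3 \<Longrightarrow> I j \<subseteq> Q" "\<And>j. j < 3 \<Longrightarrow> F j \<subseteq> Q"
  shows "is_lba \<Sigma> (sweep_lba \<Sigma> Q \<delta> I F)"
proof -
  let ?M = "sweep_lba \<Sigma> Q \<delta> I F"
  define S where "S = {Begin, Repeat, Back, Accept} \<union> (\<lambda>(j, q). Sweep j q) ` ({..<3} \<times> Q)"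
  have S: "Begin \<in> S" "Repeat \<in> S" "Back \<in> S" "Accept \<in> S"
    by (simp_all add: S_def)
  have Sweep: "Sweep j q \<in> S" if "j < 3" "q \<in> Q" for j q
    unfolding S_def using that by (intro UnI2 image_eqI[of _ _ "(j, q)"]) simp_all
  have step: "p \<in> S \<and> p' \<in> S \<and>
      (a \<in> cell ` cells \<Sigma> \<and> b \<in> cell ` cells \<Sigma> \<or>
       a = LEnd \<and> b = LEnd \<and> d \<noteq> MoveL \<or> a = REnd \<and> b = REnd \<and> d \<noteq> MoveR)"
    if "sweep_delta \<Sigma> \<delta> I F p a p' b d" for p a p' b d
    using that
  proof cases
    case (start q)
    then have "Sweep 0 q \<in> S" using Sweep[of 0 q] assms(4)[of 0] by auto
    then show ?thesis using start S by simp
  next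
    case (again j q)
    then have "j < 3" by auto
    then have "Sweep j q \<in> S" using again Sweep[of j q] assms(4)[of j] by auto
    then show ?thesis using again S by simp
  next
    case (sweep j q a' b' q')
    then have "q \<in> Q \<and> a' \<in> cells \<Sigma> \<and> b' \<in> cells \<Sigma> \<and> q' \<in> Q" using assms(3)[of j] by auto
    then show ?thesis using sweep Sweep[of j q] Sweep[of j q'] by simp
  next
    case (turn j q)
    then have "j < 3" by auto
    then have "Sweep j q \<in> S" using turn Sweep[of j q] assms(5)[of j] by auto
    then show ?thesis using turn S by simp
  next
    case (accept q)
    then have "Sweep 2 q \<in> S" using Sweep[of 2 q] assms(5)[of 2] by auto
    then show ?thesis using accept S by simp
  next
    case (backward a')
    then show ?thesis using S by simp
  next
    case left_end
    then show ?thesis using S by simp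
  qed
  have "q \<in> states ?M \<and> q' \<in> states ?M \<and>
      (a \<in> work_alphabet \<Sigma> ?M \<and> b \<in> work_alphabet \<Sigma> ?M \<or>
       a = LEnd \<and> b = LEnd \<and> d \<noteq> MoveL \<or> a = REnd \<and> b = REnd \<and> d \<noteq> MoveR)"
    if "(q, a, q', b, d) \<in> delta ?M" for q a q' b d
  proof -
    obtain p p' where p: "q = to_nat p" "q' = to_nat p'" "sweep_delta \<Sigma> \<delta> I F p a p' b d"
      using \<open>(q, a, q', b, d) \<in> delta ?M\<close> by (auto simp: sweep_lba_def)
    have "states ?M = to_nat ` S" by (simp add: sweep_lba_def S_def)
    then show ?thesis
      unfolding work_alphabet_sweep_lba p(1,2) using step[OF p(3)] by blast
  qed
  moreover have "finite (states ?M)" "finite (aux_symbols ?M)" "initial ?M \<in> states ?M"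
      "accepting ?M \<subseteq> states ?M"
    using assms(2) by (simp_all add: sweep_lba_def)
  ultimately show ?thesis
    unfolding is_lba_def using assms(1) by blast
qed

lemma sweep_step:
  "lba_step (sweep_lba \<Sigma> Q \<delta> I F) (to_nat p, i, T) c \<longleftrightarrow>
    (\<exists>p' b d. i < length T \<and> sweep_delta \<Sigma> \<delta> I F p (T ! i) p' b d \<and>
      c = (to_nat p', move d i, T[i := b]))"
  by (auto simp: lba_step.simps sweep_lba_def)

lemma sweep_stepI:
  "i < length T \<Longrightarrow> sweep_delta \<Sigma> \<delta> I F p (T ! i) p' b d \<Longrightarrow>
    lba_step (sweep_lba \<Sigma> Q \<delta> I F) (to_nat p, i, T) (to_nat p', move d i, T[i := b])"
  by (auto simp: sweep_step)

lemma sweep_run: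
  assumes "run (\<delta> j) q r r' q'" "j < 3"
  shows "(lba_step (sweep_lba \<Sigma> Q \<delta> I F))\<^sup>*\<^sup>* (to_nat (Sweep j q), Suc (length u), tape (u @ r))
    (to_nat (Sweep j q'), Suc (length (u @ r)), tape (u @ r'))"
  using assms(1)
proof (induction arbitrary: u rule: run.induct)
  case (run_Cons q a b q1 t t' q2)
  have "sweep_delta \<Sigma> \<delta> I F (Sweep j q) (tape (u @ a # t) ! Suc (length u))
      (Sweep j q1) (cell b) MoveR"
    using sweep[of j q a b q1 \<delta> \<Sigma> I F] assms(2) run_Cons(1) by (simp add: tape_nth_Suc)
  from sweep_stepI[OF _ this]
  have "lba_step (sweep_lba \<Sigma> Q \<delta> I F) (to_nat (Sweep j q), Suc (length u), tape (u @ a # t))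
      (to_nat (Sweep j q1), Suc (length (u @ [b])), tape ((u @ [b]) @ t))"
    by (simp add: tape_update)
  from converse_rtranclp_into_rtranclp[of "lba_step (sweep_lba \<Sigma> Q \<delta> I F)",
      OF this run_Cons.IH[of "u @ [b]"]]
  show ?case by simp
qed simp

lemma sweep_back:
  assumes "t \<in> lists (cells \<Sigma>)" "i \<le> length t"
  shows "(lba_step (sweep_lba \<Sigma> Q \<delta> I F))\<^sup>*\<^sup>* (to_nat Back, i, tape t) (to_nat Repeat, 0, tape t)"
  using assms(2)
proof (induction i)
  case 0
  then show ?case
    using sweep_stepI[of 0 "tape t" \<Sigma> \<delta> I F Back Repeat LEnd Stay Q] by (simp add: left_end)
next
  case (Suc i)
  then have "t ! i \<in> cells \<Sigma>" using assms(1) by auto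
  then have "sweep_delta \<Sigma> \<delta> I F Back (tape t ! Suc i) Back (cell (t ! i)) MoveL"
    using Suc.prems by (simp add: tape_nth_Suc backward)
  from sweep_stepI[OF _ this, of Q] Suc
  show ?case
    by (auto simp: tape_nth_Suc intro: converse_rtranclp_into_rtranclp)
qed

lemma sweep_whole_tape:
  assumes "run (\<delta> j) q t t' q'" "j < 3" "p = Begin \<and> j = 0 \<or> p = Repeat \<and> j \<in> {1, 2}" "q \<in> I j"
  shows "(lba_step (sweep_lba \<Sigma> Q \<delta> I F))\<^sup>*\<^sup>* (to_nat p, 0, tape t)
    (to_nat (Sweep j q'), Suc (length t'), tape t')"
proof -
  have "sweep_delta \<Sigma> \<delta> I F p (tape t ! 0) (Sweep j q) LEnd MoveR"
    using assms(2-4) by (auto intro: start again)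
  from sweep_stepI[OF _ this, of Q]
  have "lba_step (sweep_lba \<Sigma> Q \<delta> I F) (to_nat p, 0, tape t) (to_nat (Sweep j q), Suc 0, tape t)"
    by simp
  also have "(lba_step (sweep_lba \<Sigma> Q \<delta> I F))\<^sup>*\<^sup>* (to_nat (Sweep j q), Suc 0, tape t)
      (to_nat (Sweep j q'), Suc (length t'), tape t')"
    using sweep_run[of \<delta> j q t t' q' \<Sigma> Q I F "[]"] assms(1,2) run_length[OF assms(1)] by simp
  finally show ?thesis .
qed

lemma sweep_and_return:
  assumes "run (\<delta> j) q t t' q'" "p = Begin \<and> j = 0 \<or> p = Repeat \<and> j = 1" "q \<in> I j" "q' \<in> F j"
    and "t' \<in> lists (cells \<Sigma>)"
  shows "(lba_step (sweep_lba \<Sigma> Q \<delta> I F))\<^sup>*\<^sup>* (to_nat p, 0, tape t) (to_nat Repeat, 0, tape t')"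
proof -
  have "(lba_step (sweep_lba \<Sigma> Q \<delta> I F))\<^sup>*\<^sup>* (to_nat p, 0, tape t)
      (to_nat (Sweep j q'), Suc (length t'), tape t')"
    using assms by (intro sweep_whole_tape) auto
  also have "sweep_delta \<Sigma> \<delta> I F (Sweep j q') (tape t' ! Suc (length t')) Back REnd MoveL"
    using assms by (auto intro: turn)
  from sweep_stepI[OF _ this, of Q]
  have "lba_step (sweep_lba \<Sigma> Q \<delta> I F) (to_nat (Sweep j q'), Suc (length t'), tape t')
      (to_nat Back, length t', tape t')"
    by simp
  also have "(lba_step (sweep_lba \<Sigma> Q \<delta> I F))\<^sup>*\<^sup>* (to_nat Back, length t', tape t')
      (to_nat Repeat, 0, tape t')"
    using assms(5) by (intro sweep_back) auto
  finally show ?thesis .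
qed

text \<open>
  Here \<open>reached\<close> stands for the tapes with which the machine can come to \<open>Repeat\<close>. During a
  sweep the tape is part output \<open>u'\<close> and part input \<open>r\<close>; the input \<open>u\<close> that was already
  overwritten is remembered, as \<open>u @ r\<close> is the tape on which the sweep started.
\<close>

definition sweep_invariant ::
    "(nat \<Rightarrow> (nat \<times> 's option \<times> 's option \<times> nat) set) \<Rightarrow> (nat \<Rightarrow> nat set) \<Rightarrow> (nat \<Rightarrow> nat set) \<Rightarrow>
      's option list \<Rightarrow> ('s option list \<Rightarrow> bool) \<Rightarrow> 's config \<Rightarrow> bool" where
  "sweep_invariant \<delta> I F t0 reached c \<longleftrightarrow>
    (\<exists>p i T. c = (to_nat p, i, T) \<and>
      (case p of
        Begin \<Rightarrow> i = 0 \<and> T = tape t0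
      | Repeat \<Rightarrow> i = 0 \<and> (\<exists>t. T = tape t \<and> reached t)
      | Sweep j q \<Rightarrow> \<exists>u u' r q0. T = tape (u' @ r) \<and> i = Suc (length u) \<and>
          run (\<delta> j) q0 u u' q \<and> q0 \<in> I j \<and> (if j = 0 then u @ r = t0 else reached (u @ r))
      | Back \<Rightarrow> \<exists>t. T = tape t \<and> reached t
      | Accept \<Rightarrow> \<exists>t t' q q'. reached t \<and> q \<in> I 2 \<and> q' \<in> F 2 \<and> run (\<delta> 2) q t t' q'))"

lemma sweep_invariantI:
  "(case p of
        Begin \<Rightarrow> i = 0 \<and> T = tape t0
      | Repeat \<Rightarrow> i = 0 \<and> (\<exists>t. T = tape t \<and> reached t)
      | Sweep j q \<Rightarrow> \<exists>u u' r q0. T = tape (u' @ r) \<and> i = Suc (length u) \<and>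
          run (\<delta> j) q0 u u' q \<and> q0 \<in> I j \<and> (if j = 0 then u @ r = t0 else reached (u @ r))
      | Back \<Rightarrow> \<exists>t. T = tape t \<and> reached t
      | Accept \<Rightarrow> \<exists>t t' q q'. reached t \<and> q \<in> I 2 \<and> q' \<in> F 2 \<and> run (\<delta> 2) q t t' q') \<Longrightarrow>
    sweep_invariant \<delta> I F t0 reached (to_nat p, i, T)"
  unfolding sweep_invariant_def by blast

lemma sweep_invariant_step:
  assumes "sweep_invariant \<delta> I F t0 reached c" "lba_step (sweep_lba \<Sigma> Q \<delta> I F) c c'"
    and first: "\<And>t q q'. q \<in> I 0 \<Longrightarrow> q' \<in> F 0 \<Longrightarrow> run (\<delta> 0) q t0 t q' \<Longrightarrow> reached t"
    and iterate: "\<And>t t' q q'. reached t \<Longrightarrow> q \<in> I 1 \<Longrightarrow> q' \<in> F 1 \<Longrightarrow> run (\<delta> 1) q t t' q' \<Longrightarrow> reached t'"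
  shows "sweep_invariant \<delta> I F t0 reached c'"
proof -
  obtain p i T where c: "c = (to_nat p, i, T)" and inv:
    "case p of
        Begin \<Rightarrow> i = 0 \<and> T = tape t0
      | Repeat \<Rightarrow> i = 0 \<and> (\<exists>t. T = tape t \<and> reached t)
      | Sweep j q \<Rightarrow> \<exists>u u' r q0. T = tape (u' @ r) \<and> i = Suc (length u) \<and>
          run (\<delta> j) q0 u u' q \<and> q0 \<in> I j \<and> (if j = 0 then u @ r = t0 else reached (u @ r))
      | Back \<Rightarrow> \<exists>t. T = tape t \<and> reached t
      | Accept \<Rightarrow> \<exists>t t' q q'. reached t \<and> q \<in> I 2 \<and> q' \<in> F 2 \<and> run (\<delta> 2) q t t' q'"
    using assms(1) unfolding sweep_invariant_def by blast
  obtain p' b d where i: "i < length T" and delta: "sweep_delta \<Sigma> \<delta> I F p (T ! i) p' b d"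
      and c': "c' = (to_nat p', move d i, T[i := b])"
    using assms(2) unfolding c sweep_step by blast
  have at_end: "r = []" if "T = tape (u' @ r)" "i = Suc (length u')" "T ! i = REnd" for u' r
    using that by (cases r) (auto simp: tape_nth_Suc)
  show ?thesis
    unfolding c' using delta
  proof cases
    case (start q)
    with inv have "i = 0" "T = tape ([] @ t0)" by auto
    then show "sweep_invariant \<delta> I F t0 reached (to_nat p', move d i, T[i := b])"
      using start by (intro sweep_invariantI) (force intro: run_Nil)
  next
    case (again j q)
    with inv obtain t where "i = 0" "T = tape ([] @ t)" "reached t" by auto
    then show "sweep_invariant \<delta> I F t0 reached (to_nat p', move d i, T[i := b])"
      using again by (intro sweep_invariantI) (force intro: run_Nil)
  next
    case (sweep j q a b' q')
    with inv obtain u u' r q0 where T: "T = tape (u' @ r)" "i = Suc (length u)" and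
      run: "run (\<delta> j) q0 u u' q" "q0 \<in> I j" "if j = 0 then u @ r = t0 else reached (u @ r)"
      by auto
    have len: "length u' = length u" using run_length[OF run(1)] .
    have "r \<noteq> []"
      using sweep T len by (metis append_Nil2 cell_neq(4) tape_nth_end)
    then obtain a' r' where r: "r = a' # r'" by (cases r) auto
    then have "a' = a"
      using sweep T len by (simp add: tape_nth_Suc nth_append)
    have "T[i := b] = tape ((u' @ [b']) @ r')"
      using T sweep len r by (simp add: tape_update list_update_append)
    moreover have "run (\<delta> j) q0 (u @ [a]) (u' @ [b']) q'"
      using run(1) sweep by (auto intro: run_append run.intros)
    moreover have "if j = 0 then (u @ [a]) @ r' = t0 else reached ((u @ [a]) @ r')"
      using run(3) r \<open>a' = a\<close> by (simp split: if_splits)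
    moreover have "move d i = Suc (length (u @ [a]))" using sweep T by simp
    ultimately have "\<exists>u u' r q0. T[i := b] = tape (u' @ r) \<and> move d i = Suc (length u) \<and>
        run (\<delta> j) q0 u u' q' \<and> q0 \<in> I j \<and> (if j = 0 then u @ r = t0 else reached (u @ r))"
      using run(2) by blast
    moreover have "p' = Sweep j q'" using sweep by simp
    ultimately show "sweep_invariant \<delta> I F t0 reached (to_nat p', move d i, T[i := b])"
      by (intro sweep_invariantI) (simp only: sweep_state.case)
  next
    case (turn j q)
    with inv obtain u u' r q0 where T: "T = tape (u' @ r)" "i = Suc (length u)" and
      run: "run (\<delta> j) q0 u u' q" "q0 \<in> I j" "if j = 0 then u @ r = t0 else reached (u @ r)"
      by auto
    have "r = []" using at_end[OF T(1)] T(2) turn run_length[OF run(1)] by auto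
    then have "reached u'"
      using turn run first iterate by (auto split: if_splits)
    moreover have "T[i := b] = tape u'"
      using turn T \<open>r = []\<close> run_length[OF run(1)] tape_nth_end[of u'] by simp
    ultimately show "sweep_invariant \<delta> I F t0 reached (to_nat p', move d i, T[i := b])"
      using turn by (intro sweep_invariantI) auto
  next
    case (accept q)
    with inv obtain u u' r q0 where T: "T = tape (u' @ r)" "i = Suc (length u)" and
      run: "run (\<delta> 2) q0 u u' q" "q0 \<in> I 2" "reached (u @ r)"
      by auto
    have "r = []" using at_end[OF T(1)] T(2) accept run_length[OF run(1)] by auto
    then show "sweep_invariant \<delta> I F t0 reached (to_nat p', move d i, T[i := b])"
      using accept run by (intro sweep_invariantI) auto
  next
    case (backward a)
    with inv obtain t where "T = tape t" "reached t" by auto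
    then show "sweep_invariant \<delta> I F t0 reached (to_nat p', move d i, T[i := b])"
      using backward by (intro sweep_invariantI) auto
  next
    case left_end
    with inv obtain t where "T = tape t" "reached t" by auto
    then show "sweep_invariant \<delta> I F t0 reached (to_nat p', move d i, T[i := b])"
      using left_end i tape_nth_LEnd[of i t] by (intro sweep_invariantI) auto
  qed
qed

lemma lba_language_sweep_lba:
  assumes \<delta>: "\<And>j. j < 3 \<Longrightarrow> \<delta> j \<subseteq> Q \<times> cells \<Sigma> \<times> cells \<Sigma> \<times> Q"
    and R: "\<And>j. j < 3 \<Longrightarrow> R j = (\<lambda>t t'. \<exists>q \<in> I j. \<exists>q' \<in> F j. run (\<delta> j) q t t' q')"
  shows "lba_language \<Sigma> (sweep_lba \<Sigma> Q \<delta> I F) =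
    {w \<in> lists \<Sigma>. \<exists>t0 t1 t2. R 0 (map Some w) t0 \<and> (R 1)\<^sup>*\<^sup>* t0 t1 \<and> R 2 t1 t2}"
proof -
  let ?M = "sweep_lba \<Sigma> Q \<delta> I F"
  have initial: "initial_config ?M w = (to_nat Begin, 0, tape (map Some w))" for w
    by (simp add: initial_config_def sweep_lba_def tape_def comp_def)
  have accepting: "accepting ?M = {to_nat Accept}"
    by (simp add: sweep_lba_def)
  have in_lists: "t' \<in> lists (cells \<Sigma>)" if step: "R j t t'" and j: "j < 3" for j t t'
  proof -
    obtain q q' where "run (\<delta> j) q t t' q'" using step R[OF j] by auto
    from run_in_lists[OF this \<delta>[OF j]] show ?thesis by blast
  qed
  have "(\<exists>t0 t1 t2. R 0 (map Some w) t0 \<and> (R 1)\<^sup>*\<^sup>* t0 t1 \<and> R 2 t1 t2) \<longleftrightarrow>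
      (\<exists>i T. (lba_step ?M)\<^sup>*\<^sup>* (to_nat Begin, 0, tape (map Some w)) (to_nat Accept, i, T))"
    (is "?L w \<longleftrightarrow> ?R w") for w
  proof
    assume "?L w"
    then obtain t0 t1 t2 where t: "R 0 (map Some w) t0" "(R 1)\<^sup>*\<^sup>* t0 t1" "R 2 t1 t2" by blast
    obtain q0 q0' where "q0 \<in> I 0" "q0' \<in> F 0" "run (\<delta> 0) q0 (map Some w) t0 q0'"
      using t(1) R[of 0] by auto
    then have "(lba_step ?M)\<^sup>*\<^sup>* (to_nat Begin, 0, tape (map Some w)) (to_nat Repeat, 0, tape t0)"
      using in_lists[OF t(1)] by (intro sweep_and_return[of \<delta> 0 q0 _ _ q0']) simp_all
    also have "(lba_step ?M)\<^sup>*\<^sup>* (to_nat Repeat, 0, tape t0) (to_nat Repeat, 0, tape t1)"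
      using t(2)
    proof (induction rule: rtranclp_induct)
      case (step t t')
      obtain q q' where "q \<in> I 1" "q' \<in> F 1" "run (\<delta> 1) q t t' q'"
        using step(2) R[of 1] by auto
      then have "(lba_step ?M)\<^sup>*\<^sup>* (to_nat Repeat, 0, tape t) (to_nat Repeat, 0, tape t')"
        using in_lists[OF step(2)] by (intro sweep_and_return[of \<delta> 1 q _ _ q']) simp_all
      with step.IH show ?case by (rule rtranclp_trans)
    qed simp
    also obtain q q' where q: "q \<in> I 2" "q' \<in> F 2" "run (\<delta> 2) q t1 t2 q'"
      using t(3) R[of 2] by auto
    then have "(lba_step ?M)\<^sup>*\<^sup>* (to_nat Repeat, 0, tape t1)
        (to_nat (Sweep 2 q'), Suc (length t2), tape t2)"
      by (intro sweep_whole_tape[of \<delta> 2 q]) simp_all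
    also have "lba_step ?M (to_nat (Sweep 2 q'), Suc (length t2), tape t2)
        (to_nat Accept, Suc (length t2), tape t2)"
      using sweep_stepI[of "Suc (length t2)" "tape t2" \<Sigma> \<delta> I F "Sweep 2 q'" Accept REnd Stay Q] q
      by (simp add: accept)
    finally show "?R w" by blast
  next
    assume "?R w"
    then obtain i T where steps:
      "(lba_step ?M)\<^sup>*\<^sup>* (to_nat Begin, 0, tape (map Some w)) (to_nat Accept, i, T)" by blast
    define reached where "reached t \<longleftrightarrow> (\<exists>t0. R 0 (map Some w) t0 \<and> (R 1)\<^sup>*\<^sup>* t0 t)" for t
    have first: "reached t" if "q \<in> I 0" "q' \<in> F 0" "run (\<delta> 0) q (map Some w) t q'" for t q q'
      unfolding reached_def using that R[of 0] by auto
    have nxt: "reached t'" if "reached t" "q \<in> I 1" "q' \<in> F 1" "run (\<delta> 1) q t t' q'" for t t' q q'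
    proof -
      have "R 1 t t'" using that R[of 1] by auto
      with that(1) show ?thesis
        unfolding reached_def by (blast intro: rtranclp.rtrancl_into_rtrancl)
    qed
    from steps have "sweep_invariant \<delta> I F (map Some w) reached (to_nat Accept, i, T)"
    proof (induction rule: rtranclp_induct)
      case base
      show ?case by (rule sweep_invariantI) simp
    next
      case (step c c')
      show ?case
        by (rule sweep_invariant_step[OF step.IH step(2)]) (fact first, fact nxt)
    qed
    then obtain t t' q q' where "reached t" "q \<in> I 2" "q' \<in> F 2" "run (\<delta> 2) q t t' q'"
      unfolding sweep_invariant_def by auto
    moreover from this have "R 2 t t'" using R[of 2] by auto
    ultimately show "?L w" unfolding reached_def by blast
  qed
  then show ?thesis
    unfolding lba_language_def initial accepting by auto
qed

theorem context_sensitive_sweeps: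
  assumes "finite \<Sigma>"
    and "finite_state_relation \<Sigma> R0" "finite_state_relation \<Sigma> R1" "finite_state_relation \<Sigma> R2"
  shows "context_sensitive \<Sigma>
    {w \<in> lists \<Sigma>. \<exists>t0 t1 t2. R0 (map Some w) t0 \<and> R1\<^sup>*\<^sup>* t0 t1 \<and> R2 t1 t2}"
proof -
  obtain Q0 :: "nat set" and \<delta>0 I0 F0 where 0: "finite Q0"
      "\<delta>0 \<subseteq> Q0 \<times> cells \<Sigma> \<times> cells \<Sigma> \<times> Q0" "I0 \<subseteq> Q0" "F0 \<subseteq> Q0"
      "R0 = (\<lambda>t t'. \<exists>q \<in> I0. \<exists>q' \<in> F0. run \<delta>0 q t t' q')"
    using assms(2) unfolding finite_state_relation_def by blast
  obtain Q1 :: "nat set" and \<delta>1 I1 F1 where 1: "finite Q1"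
      "\<delta>1 \<subseteq> Q1 \<times> cells \<Sigma> \<times> cells \<Sigma> \<times> Q1" "I1 \<subseteq> Q1" "F1 \<subseteq> Q1"
      "R1 = (\<lambda>t t'. \<exists>q \<in> I1. \<exists>q' \<in> F1. run \<delta>1 q t t' q')"
    using assms(3) unfolding finite_state_relation_def by blast
  obtain Q2 :: "nat set" and \<delta>2 I2 F2 where 2: "finite Q2"
      "\<delta>2 \<subseteq> Q2 \<times> cells \<Sigma> \<times> cells \<Sigma> \<times> Q2" "I2 \<subseteq> Q2" "F2 \<subseteq> Q2"
      "R2 = (\<lambda>t t'. \<exists>q \<in> I2. \<exists>q' \<in> F2. run \<delta>2 q t t' q')"
    using assms(4) unfolding finite_state_relation_def by blast
  define Q where "Q = Q0 \<union> Q1 \<union> Q2"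
  define \<delta> where "\<delta> j = [\<delta>0, \<delta>1, \<delta>2] ! j" for j
  define I where "I j = [I0, I1, I2] ! j" for j
  define F where "F j = [F0, F1, F2] ! j" for j
  define R where "R j = [R0, R1, R2] ! j" for j
  have cases: "P j" if "P 0" "P 1" "P 2" "j < 3" for P and j :: nat
  proof -
    have "j = 0 \<or> j = 1 \<or> j = 2" using that(4) by arith
    then show ?thesis using that by blast
  qed
  have \<delta>: "\<delta> j \<subseteq> Q \<times> cells \<Sigma> \<times> cells \<Sigma> \<times> Q" if "j < 3" for j
    by (rule cases[OF _ _ _ that]) (use 0 1 2 in \<open>auto simp: \<delta>_def Q_def\<close>)
  have "R j = (\<lambda>t t'. \<exists>q \<in> I j. \<exists>q' \<in> F j. run (\<delta> j) q t t' q')" if "j < 3" for j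
    by (rule cases[OF _ _ _ that]) (simp_all add: R_def I_def F_def \<delta>_def 0(5) 1(5) 2(5))
  note lang = lba_language_sweep_lba[of \<delta> Q \<Sigma> R I F, OF \<delta> this]
  have "I j \<subseteq> Q" if "j < 3" for j
    by (rule cases[OF _ _ _ that]) (use 0 1 2 in \<open>auto simp: I_def Q_def\<close>)
  moreover have "F j \<subseteq> Q" if "j < 3" for j
    by (rule cases[OF _ _ _ that]) (use 0 1 2 in \<open>auto simp: F_def Q_def\<close>)
  moreover have "finite Q" using 0 1 2 by (simp add: Q_def)
  ultimately have "is_lba \<Sigma> (sweep_lba \<Sigma> Q \<delta> I F)"
    using assms(1) \<delta> by (intro is_lba_sweep_lba) auto
  moreover have "R 0 = R0" "R 1 = R1" "R 2 = R2" by (simp_all add: R_def)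
  ultimately show ?thesis
    unfolding context_sensitive_def using lang by auto
qed


section \<open>Words on a tape\<close>

fun contents :: "'s option list \<Rightarrow> 's list" where
  "contents [] = []"
| "contents (c # t) = cons_option c (contents t)"

lemma contents_map_Some [simp]: "contents (map Some s) = s"
  by (induction s) auto

text \<open>
  The inverse of \<open>hash_join\<close> on nonempty lists. The empty string stands both for no word and
  for one empty word; it is decoded as the latter.
\<close>

fun words :: "'a symbol list \<Rightarrow> 'a word list" where
  "words [] = [[]]"
| "words (Hash # s) = [] # words s"
| "words (Letter a # s) = (a # hd (words s)) # tl (words s)"

lemma words_not_Nil [simp]: "words s \<noteq> []"
  by (cases s rule: words.cases) auto

lemma hd_tl_words [simp]: "hd (words s) # tl (words s) = words s"
  by simp

lemma hash_join_Cons: "hash_join ((a # w) # ws) = Letter a # hash_join (w # ws)"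
  by (cases ws) auto

lemma hash_join_Nil: "ws \<noteq> [] \<Longrightarrow> hash_join ([] # ws) = Hash # hash_join ws"
  by (cases ws) auto

lemma hash_join_words [simp]: "hash_join (words s) = s"
proof (induction s rule: words.induct)
  case (3 a s)
  then show ?case by (simp add: hash_join_Cons)
qed (simp_all add: hash_join_Nil)

lemma words_hash_join [simp]: "ws \<noteq> [] \<Longrightarrow> words (hash_join ws) = ws"
proof (induction ws)
  case (Cons w ws)
  have map: "words (map Letter w) = [w]" for w :: "'a word"
    by (induction w) auto
  show ?case
  proof (cases "ws = []")
    case True
    then show ?thesis by (simp add: map)
  next
    case False
    then show ?thesis
      using Cons.IH by (induction w) (simp_all add: hash_join_Cons hash_join_Nil)
  qed
qed simp

lemma hash_join_in_lists:
  "set ws \<subseteq> lists (X \<times> UNIV) \<Longrightarrow> hash_join ws \<in> lists (hash_alphabet X)"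
  by (induction ws rule: hash_join.induct) (fastforce simp: hash_alphabet_def)+

lemma words_in_lists:
  "s \<in> lists (hash_alphabet X) \<Longrightarrow> set (words s) \<subseteq> lists (X \<times> UNIV)"
proof (induction s rule: words.induct)
  case (3 a s)
  then have IH: "set (words s) \<subseteq> lists (X \<times> UNIV)" and a: "a \<in> X \<times> UNIV"
    by (auto simp: hash_alphabet_def)
  have "hd (words s) \<in> set (words s)" "set (tl (words s)) \<subseteq> set (words s)"
    by (simp_all add: list.set_sel subsetI)
  then have "hd (words s) \<in> lists (X \<times> UNIV)" "set (tl (words s)) \<subseteq> lists (X \<times> UNIV)"
    using IH by blast+
  with a show ?case by simp
qed (auto simp: hash_alphabet_def)

inductive tape_step ::
    "'a letter \<Rightarrow> 'a set \<Rightarrow> 'a set \<Rightarrow> bool \<Rightarrow> 'a symbol option \<Rightarrow> 'a symbol option \<Rightarrow> bool \<Rightarrow> bool"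
  for \<beta> S T where
  blank: "tape_step \<beta> S T p None None p"
| hash: "tape_step \<beta> S T False (Some Hash) (Some Hash) False"
| letter: "collapse \<beta> S T p a o' q \<Longrightarrow>
    tape_step \<beta> S T p (Some (Letter a)) (map_option Letter o') q"

definition tape_delta where
  "tape_delta \<beta> S T = {(p, c, c', q). tape_step \<beta> S T p c c' q}"

lemma tape_step_output: "tape_step \<beta> S T p c c' q \<Longrightarrow> c' = None \<or> c' = c"
  by (auto elim!: tape_step.cases dest: collapse_output)

text \<open>
  Collapsing a sequence of words: within the first word the walk is at \<open>p\<close>, all other words
  are closed walks from the base point.
\<close>

definition collapse_words where
  "collapse_words \<beta> S T p ws ws' \<longleftrightarrow> ws \<noteq> [] \<and> ws' \<noteq> [] \<and>
    collapse_word \<beta> S T p (hd ws) (hd ws') False \<and>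
    list_all2 (\<lambda>w w'. collapse_word \<beta> S T False w w' False) (tl ws) (tl ws')"

lemma collapse_words_False:
  "ws \<noteq> [] \<Longrightarrow> collapse_words \<beta> S T False ws ws' \<longleftrightarrow>
    list_all2 (\<lambda>w w'. collapse_word \<beta> S T False w w' False) ws ws'"
  by (cases ws; cases ws') (auto simp: collapse_words_def)

lemma collapse_word_Nil_iff [simp]: "collapse_word \<beta> S T p [] w' q \<longleftrightarrow> w' = [] \<and> q = p"
  by (auto elim: collapse_word.cases intro: collapse_Nil)

lemma words_cons_option:
  "words (cons_option (map_option Letter o') s) = cons_option o' (hd (words s)) # tl (words s)"
  by (cases o') auto

lemma run_collapse_words:
  assumes "run (tape_delta \<beta> S T) p t t' q" "\<not> q"
  shows "collapse_words \<beta> S T p (words (contents t)) (words (contents t'))"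
  using assms
proof (induction rule: run.induct)
  case (run_Nil p)
  then show ?case by (simp add: collapse_words_def)
next
  case (run_Cons p c c' q t t' r)
  then have IH: "collapse_words \<beta> S T q (words (contents t)) (words (contents t'))" by blast
  have "tape_step \<beta> S T p c c' q" using run_Cons(1) by (simp add: tape_delta_def)
  then show ?case
  proof cases
    case hash
    then have "list_all2 (\<lambda>w w'. collapse_word \<beta> S T False w w' False)
        (words (contents t)) (words (contents t'))"
      using IH by (simp add: collapse_words_False)
    then show ?thesis using hash by (simp add: collapse_words_def)
  next
    case (letter a o')
    then show ?thesis
      using IH by (auto simp: collapse_words_def words_cons_option intro: collapse_Cons)
  qed (use IH in simp)
qed

lemma collapse_words_run:
  assumes "collapse_words \<beta> S T p (words (contents t)) ws'"
  shows "\<exists>t'. run (tape_delta \<beta> S T) p t t' False \<and> words (contents t') = ws'"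
  using assms
proof (induction t arbitrary: p ws')
  case Nil
  then have "ws' = [[]]" "\<not> p" by (cases ws'; simp add: collapse_words_def)+
  then show ?case by (intro exI[of _ "[]"]) (auto intro: run_Nil)
next
  case (Cons c t)
  obtain w' ws where ws': "ws' = w' # ws" using Cons.prems by (cases ws') (auto simp: collapse_words_def)
  have step: ?case if rest: "collapse_words \<beta> S T q (words (contents t)) ws1"
      and first: "tape_step \<beta> S T p c c' q"
      and ws1: "\<And>t'. words (contents t') = ws1 \<Longrightarrow> words (contents (c' # t')) = ws'" for c' q ws1
  proof -
    obtain t' where t': "run (tape_delta \<beta> S T) q t t' False" "words (contents t') = ws1"
      using Cons.IH[OF rest] by blast
    have "run (tape_delta \<beta> S T) p (c # t) (c' # t') False"
      using first t'(1) by (intro run_Cons) (simp add: tape_delta_def)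
    then show ?thesis using ws1[OF t'(2)] by blast
  qed
  consider "c = None" | "c = Some Hash" | a where "c = Some (Letter a)"
    by (metis option.exhaust symbol.exhaust)
  then show ?case
  proof cases
    case 1
    then show ?thesis using Cons.prems by (intro step[of p ws' None]) (auto intro: blank)
  next
    case 2
    then have "w' = []" "\<not> p"
        and "list_all2 (\<lambda>w w'. collapse_word \<beta> S T False w w' False) (words (contents t)) ws"
      using Cons.prems ws' by (simp_all add: collapse_words_def)
    moreover from this(3) have "collapse_words \<beta> S T False (words (contents t)) ws"
      by (simp add: collapse_words_False)
    ultimately show ?thesis
      using 2 ws' by (intro step[of False ws "Some Hash"]) (auto intro: hash)
  next
    case (3 a)
    then have "collapse_word \<beta> S T p (a # hd (words (contents t))) w' False"
      using Cons.prems ws' by (simp add: collapse_words_def)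
    then obtain o' q w1 where o': "collapse \<beta> S T p a o' q" "w' = cons_option o' w1"
        "collapse_word \<beta> S T q (hd (words (contents t))) w1 False"
      by (cases rule: collapse_word.cases) auto
    then have "collapse_words \<beta> S T q (words (contents t)) (w1 # ws)"
      using Cons.prems ws' 3 by (simp add: collapse_words_def)
    then show ?thesis
      using 3 o' ws'
      by (intro step[of q "w1 # ws" "map_option Letter o'"]) (auto intro: letter simp: words_cons_option)
  qed
qed


section \<open>The three sweeps\<close>

lemma finite_hash_alphabet: "finite X \<Longrightarrow> finite (hash_alphabet X)"
  by (simp add: hash_alphabet_def)

text \<open>A finite language is recognised by an automaton whose state is the suffix still expected.\<close>

lemma finite_language_relation:
  assumes "finite \<Sigma>" "finite D" "D \<subseteq> lists \<Sigma>"
  shows "finite_state_relation \<Sigma> (\<lambda>t t'. t' = t \<and> t \<in> lists (cells \<Sigma>) \<and> contents t \<in> D)"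
proof -
  obtain m where m: "\<forall>s \<in> D. length s \<le> m"
    using assms(2) finite_nat_set_iff_bounded_le[of "length ` D"] by auto
  define Q where "Q = {s. set s \<subseteq> \<Sigma> \<and> length s \<le> m}"
  define \<delta> where "\<delta> = {(s, None, None, s) | s. s \<in> Q} \<union> {(c # s, Some c, Some c, s) | c s. c # s \<in> Q}"
  have sound: "t' = t \<and> t \<in> lists (cells \<Sigma>) \<and> contents t = s" if "run \<delta> s t t' q" "q = []" for s t t' q
    using that by (induction rule: run.induct) (auto simp: \<delta>_def Q_def cells_def)
  have complete: "run \<delta> (contents t) t t []" if "contents t \<in> Q" for t
    using that
  proof (induction t)
    case (Cons c t)
    show ?case
    proof (cases c)
      case None
      then show ?thesis using Cons by (auto intro!: run_Cons simp: \<delta>_def)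
    next
      case (Some d)
      moreover from this have "contents t \<in> Q" using Cons.prems by (auto simp: Q_def)
      ultimately show ?thesis using Cons by (auto intro!: run_Cons simp: \<delta>_def)
    qed
  qed (simp add: run_Nil)
  have "D \<subseteq> Q" using m assms(3) by (auto simp: Q_def)
  then have "(t' = t \<and> t \<in> lists (cells \<Sigma>) \<and> contents t \<in> D) \<longleftrightarrow>
      (\<exists>q \<in> D. \<exists>q' \<in> {[]}. run \<delta> q t t' q')" for t t'
    using sound complete by blast
  moreover have "finite_state_relation \<Sigma> (\<lambda>t t'. \<exists>q \<in> D. \<exists>q' \<in> {[]}. run \<delta> q t t' q')"
  proof (rule finite_state_relationI)
    show "finite Q" unfolding Q_def using assms(1) by (rule finite_lists_length_le)
    show "\<delta> \<subseteq> Q \<times> cells \<Sigma> \<times> cells \<Sigma> \<times> Q" by (auto simp: \<delta>_def Q_def cells_def)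
    show "D \<subseteq> Q" by fact
    show "{[]} \<subseteq> Q" by (simp add: Q_def)
  qed
  ultimately show ?thesis by simp
qed

definition cancels :: "'a symbol option \<Rightarrow> 'a symbol \<Rightarrow> bool" where
  "cancels p c \<longleftrightarrow> (\<exists>a. p = Some (Letter a) \<and> c = Letter (inv_letter a))"

fun cancellation_free :: "'a symbol option \<Rightarrow> 'a symbol list \<Rightarrow> bool" where
  "cancellation_free p [] \<longleftrightarrow> True"
| "cancellation_free p (c # s) \<longleftrightarrow> \<not> cancels p c \<and> cancellation_free (Some c) s"

definition pending :: "'a symbol option \<Rightarrow> 'a word" where
  "pending p = (case p of Some (Letter a) \<Rightarrow> [a] | _ \<Rightarrow> [])"

text \<open>
  Reducedness of all words on the tape is checked by comparing neighbouring symbols: no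
  letter may cancel against its predecessor \<open>p\<close>, and a \<open>Hash\<close> makes the machine forget it.
\<close>

lemma cancellation_free_reduced:
  "cancellation_free p s \<longleftrightarrow>
    reduced (pending p @ hd (words s)) \<and> (\<forall>w \<in> set (tl (words s)). reduced w)"
proof (induction s arbitrary: p)
  case Nil
  then show ?case by (auto simp: pending_def reduced_Cons split: option.split symbol.split)
next
  case (Cons c s)
  show ?case
  proof (cases c)
    case (Letter a)
    have "reduced (pending p @ a # hd (words s)) \<longleftrightarrow> \<not> cancels p c \<and> reduced (a # hd (words s))"
      using Letter
      by (auto simp: pending_def cancels_def reduced_Cons split: option.split symbol.split)
    then show ?thesis
      using Cons.IH[of "Some c"] Letter by (auto simp: pending_def)
  next
    case Hash
    have "reduced (pending p)" "\<not> cancels p c"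
      using Hash by (auto simp: pending_def cancels_def reduced_Cons split: option.split symbol.split)
    moreover have "cancellation_free (Some c) s \<longleftrightarrow> (\<forall>w \<in> set (words s). reduced w)"
    proof -
      have "set (words s) = insert (hd (words s)) (set (tl (words s)))"
        by (metis hd_tl_words list.simps(15))
      then show ?thesis using Cons.IH[of "Some c"] Hash by (simp add: pending_def)
    qed
    ultimately show ?thesis using Hash by simp
  qed
qed

lemma reduced_words_iff: "(\<forall>w \<in> set (words s). reduced w) \<longleftrightarrow> cancellation_free None s"
proof -
  have "set (words s) = insert (hd (words s)) (set (tl (words s)))"
    by (metis hd_tl_words list.simps(15))
  then show ?thesis by (simp add: cancellation_free_reduced pending_def)
qed

lemma reduced_relation:
  assumes "finite (\<Sigma> :: 'a symbol set)"
  shows "\<exists>R. finite_state_relation \<Sigma> R \<and>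
    (\<forall>s \<in> lists \<Sigma>. \<forall>t. R (map Some s) t \<longleftrightarrow> t = map Some s \<and> (\<forall>w \<in> set (words s). reduced w))"
proof -
  define Q where "Q = cells \<Sigma>"
  define \<delta> where "\<delta> = {(p, Some c, Some c, Some c) | p c. p \<in> Q \<and> c \<in> \<Sigma> \<and> \<not> cancels p c}"
  have run: "(\<exists>q \<in> Q. run \<delta> p (map Some s) t q) \<longleftrightarrow> t = map Some s \<and> cancellation_free p s"
    if "s \<in> lists \<Sigma>" "p \<in> Q" for p s t
    using that
  proof (induction s arbitrary: p t rule: list.induct)
    case Nil
    then show ?case by (auto intro: run_Nil elim: run.cases)
  next
    case (Cons c s)
    then have c: "c \<in> \<Sigma>" "Some c \<in> Q" and s: "s \<in> lists \<Sigma>" by (auto simp: Q_def cells_def)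
    have "(p, Some c, b, q) \<in> \<delta> \<longleftrightarrow> b = Some c \<and> q = Some c \<and> \<not> cancels p c" for b q
      using c(1) Cons.prems(2) by (auto simp: \<delta>_def)
    then have "(\<exists>q \<in> Q. run \<delta> p (Some c # map Some s) t q) \<longleftrightarrow>
        (\<exists>t'. t = Some c # t' \<and> \<not> cancels p c \<and> (\<exists>q \<in> Q. run \<delta> (Some c) (map Some s) t' q))"
      by (auto simp: run_Cons_iff)
    then show ?case using Cons.IH[OF s c(2)] by auto
  qed
  let ?R = "\<lambda>t t'. \<exists>p \<in> {None}. \<exists>q \<in> Q. run \<delta> p t t' q"
  have "None \<in> Q" by (simp add: Q_def cells_def)
  have "?R (map Some s) t \<longleftrightarrow> t = map Some s \<and> (\<forall>w \<in> set (words s). reduced w)"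
    if "s \<in> lists \<Sigma>" for s t
    using run[OF that \<open>None \<in> Q\<close>, of t] unfolding reduced_words_iff by simp
  moreover have "finite_state_relation \<Sigma> ?R"
  proof (rule finite_state_relationI)
    show "finite Q" using assms by (simp add: Q_def cells_def)
    show "\<delta> \<subseteq> Q \<times> cells \<Sigma> \<times> cells \<Sigma> \<times> Q" unfolding \<delta>_def Q_def cells_def by blast
    show "{None} \<subseteq> Q" by (simp add: Q_def cells_def)
  qed simp
  ultimately show ?thesis by (intro exI[of _ ?R]) simp
qed

lemma run_tape_delta_in_lists:
  "run (tape_delta \<beta> S T) p t t' q \<Longrightarrow> t \<in> lists (cells \<Sigma>) \<Longrightarrow> t' \<in> lists (cells \<Sigma>)"
proof (induction rule: run.induct)
  case (run_Cons p c c' q t t' r)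
  then have "c' = None \<or> c' = c" using tape_step_output by (simp add: tape_delta_def)
  then show ?case using run_Cons by (auto simp: cells_def)
qed simp

definition collapse_relation ::
    "'a set \<Rightarrow> 'a symbol option list \<Rightarrow> 'a symbol option list \<Rightarrow> bool" where
  "collapse_relation X t t' \<longleftrightarrow>
    t \<in> lists (cells (hash_alphabet X)) \<and>
    (\<exists>\<beta> S T. \<beta> \<in> X \<times> UNIV \<and> S \<subseteq> X \<and> T \<subseteq> X \<and> run (tape_delta \<beta> S T) False t t' False)"

lemma finite_state_collapse_relation:
  assumes "finite X"
  shows "finite_state_relation (hash_alphabet X) (collapse_relation X)"
proof -
  let ?\<Gamma> = "cells (hash_alphabet X)"
  define P where "P = (X \<times> (UNIV :: bool set)) \<times> Pow X \<times> Pow X"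
  define \<delta> where "\<delta> = {(((\<beta>, S, T), p), c, c', ((\<beta>, S, T), q)) | \<beta> S T p c c' q.
    (\<beta>, S, T) \<in> P \<and> c \<in> ?\<Gamma> \<and> (p, c, c', q) \<in> tape_delta \<beta> S T}"
  have sound: "t \<in> lists ?\<Gamma> \<and> run (tape_delta \<beta> S T) p t t' q \<and> x = (\<beta>, S, T)"
    if "run \<delta> y t t' z" "y = ((\<beta>, S, T), p)" "z = (x, q)" for \<beta> S T p t t' x y z q
    using that
  proof (induction arbitrary: p rule: run.induct)
    case (run_Cons y c c' y1 t t' z)
    then obtain p1 where "y1 = ((\<beta>, S, T), p1)" "c \<in> ?\<Gamma>" "(p, c, c', p1) \<in> tape_delta \<beta> S T"
      by (auto simp: \<delta>_def)
    then show ?case using run_Cons.IH[of p1] run_Cons.prems by (auto intro: run.run_Cons)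
  qed (auto intro: run.run_Nil)
  have complete: "run \<delta> ((\<beta>, S, T), p) t t' ((\<beta>, S, T), q)"
    if "run (tape_delta \<beta> S T) p t t' q" "t \<in> lists ?\<Gamma>" "(\<beta>, S, T) \<in> P" for \<beta> S T p t t' q
    using that
  proof (induction rule: run.induct)
    case (run_Cons p c c' p1 t t' q)
    then have "(((\<beta>, S, T), p), c, c', ((\<beta>, S, T), p1)) \<in> \<delta>"
      by (cases \<beta>) (auto simp: \<delta>_def)
    then show ?case using run_Cons by (auto intro: run.run_Cons)
  qed (rule run.run_Nil)
  let ?I = "(\<lambda>x. (x, False)) ` P"
  have "collapse_relation X t t' \<longleftrightarrow> (\<exists>y \<in> ?I. \<exists>z \<in> ?I. run \<delta> y t t' z)" for t t'
  proof
    assume "collapse_relation X t t'"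
    then obtain \<beta> S T where "t \<in> lists ?\<Gamma>" "(\<beta>, S, T) \<in> P"
        "run (tape_delta \<beta> S T) False t t' False"
      unfolding collapse_relation_def P_def by blast
    then show "\<exists>y \<in> ?I. \<exists>z \<in> ?I. run \<delta> y t t' z" using complete by blast
  next
    assume "\<exists>y \<in> ?I. \<exists>z \<in> ?I. run \<delta> y t t' z"
    then obtain \<beta> S T x where "(\<beta>, S, T) \<in> P" "run \<delta> ((\<beta>, S, T), False) t t' (x, False)"
      by auto
    moreover from this sound have "t \<in> lists ?\<Gamma>" "run (tape_delta \<beta> S T) False t t' False"
      by blast+
    ultimately show "collapse_relation X t t'"
      unfolding collapse_relation_def P_def by blast
  qed
  then have "collapse_relation X = (\<lambda>t t'. \<exists>y \<in> ?I. \<exists>z \<in> ?I. run \<delta> y t t' z)"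
    by (intro ext)
  moreover have "finite_state_relation (hash_alphabet X) (\<lambda>t t'. \<exists>y \<in> ?I. \<exists>z \<in> ?I. run \<delta> y t t' z)"
  proof (rule finite_state_relationI)
    show "finite (P \<times> (UNIV :: bool set))" using assms by (simp add: P_def)
    have "c' \<in> ?\<Gamma>" if "(p, c, c', q) \<in> tape_delta \<beta> S T" "c \<in> ?\<Gamma>" for \<beta> S T p c c' q
      using that tape_step_output[of \<beta> S T p c c' q] by (auto simp: tape_delta_def cells_def)
    then show "\<delta> \<subseteq> (P \<times> UNIV) \<times> ?\<Gamma> \<times> ?\<Gamma> \<times> (P \<times> UNIV)"
      by (auto simp: \<delta>_def)
    show "?I \<subseteq> P \<times> UNIV" by blast
    then show "?I \<subseteq> P \<times> UNIV" .
  qed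
  ultimately show ?thesis by simp
qed


section \<open>Recognising primitive sets\<close>

definition standard_strings :: "'a set \<Rightarrow> nat \<Rightarrow> 'a symbol list set" where
  "standard_strings X n =
    {hash_join (map (\<lambda>a. [a]) as) | as.
      length as = n \<and> distinct (map fst as) \<and> set as \<subseteq> X \<times> UNIV}"

lemma standard_strings_in_lists: "standard_strings X n \<subseteq> lists (hash_alphabet X)"
proof
  fix s assume "s \<in> standard_strings X n"
  then obtain as where "s = hash_join (map (\<lambda>a. [a]) as)" "set as \<subseteq> X \<times> UNIV"
    unfolding standard_strings_def by blast
  moreover from this have "set (map (\<lambda>a. [a]) as) \<subseteq> lists (X \<times> UNIV)" by auto
  ultimately show "s \<in> lists (hash_alphabet X)" using hash_join_in_lists by blast
qed

lemma finite_standard_strings: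
  assumes "finite X"
  shows "finite (standard_strings X n)"
proof -
  have "standard_strings X n \<subseteq>
      (\<lambda>as. hash_join (map (\<lambda>a. [a]) as)) ` {as. set as \<subseteq> X \<times> UNIV \<and> length as = n}"
    unfolding standard_strings_def by blast
  moreover have "finite {as. set as \<subseteq> X \<times> (UNIV :: bool set) \<and> length as = n}"
    using assms by (intro finite_lists_length_eq) simp
  ultimately show ?thesis using finite_surj by blast
qed

definition primitive_words :: "'a set \<Rightarrow> 'a word list \<Rightarrow> bool" where
  "primitive_words X ws \<longleftrightarrow>
    (\<exists>\<sigma> xs. automorphism_words X \<sigma> \<and> distinct xs \<and> set xs \<subseteq> X \<and>
      list_all2 (\<lambda>w x. w \<sim> \<sigma> x) ws xs)"

lemma primitive_words_letters:
  assumes "distinct (map fst as)" "set as \<subseteq> X \<times> UNIV"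
  shows "primitive_words X (map (\<lambda>a. [a]) as)"
proof -
  \<comment> \<open>The involution that inverts the generators whose inverses occur.\<close>
  define \<sigma> where "\<sigma> x = [(x, (x, False) \<notin> set as)]" for x
  have "lift \<sigma> (\<sigma> x) = [(x, True)]" for x
    by (simp add: \<sigma>_def inv_letter_def)
  moreover have "\<sigma> x \<in> lists (X \<times> UNIV)" if "x \<in> X" for x
    using that by (simp add: \<sigma>_def)
  ultimately have "automorphism_words X \<sigma>"
    unfolding automorphism_words_def by (intro conjI exI[of _ \<sigma>] ballI) simp_all
  moreover have "\<sigma> (fst a) = [a]" if "a \<in> set as" for a
  proof (cases a)
    case (Pair x b)
    have "(x, b) \<in> set as" "(x, \<not> b) \<notin> set as"
      using that Pair assms(1) eq_key_imp_eq_value[of as x b "\<not> b"] by auto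
    then show ?thesis using Pair by (cases b) (auto simp: \<sigma>_def)
  qed
  then have "list_all2 (\<lambda>w x. w \<sim> \<sigma> x) (map (\<lambda>a. [a]) as) (map fst as)"
    by (simp add: list_all2_conv_all_nth)
  ultimately show ?thesis
    using assms unfolding primitive_words_def by (intro exI[of _ \<sigma>] exI[of _ "map fst as"]) auto
qed

lemma primitive_words_automorphism:
  assumes "primitive_words X ws'" "automorphism_words X \<theta>"
    and "list_all2 (\<lambda>w w'. w \<sim> lift \<theta> w') ws ws'"
  shows "primitive_words X ws"
proof -
  obtain \<sigma> xs where \<sigma>: "automorphism_words X \<sigma>" "distinct xs" "set xs \<subseteq> X"
      "list_all2 (\<lambda>w x. w \<sim> \<sigma> x) ws' xs"
    using assms(1) unfolding primitive_words_def by blast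
  have "list_all2 (\<lambda>w x. w \<sim> lift \<theta> (\<sigma> x)) ws xs"
    using assms(3) \<sigma>(4) by (rule list_all2_trans[rotated]) (metis lift_cong)
  then show ?thesis
    unfolding primitive_words_def
    using automorphism_words_comp[OF assms(2) \<sigma>(1)] \<sigma>(2,3) by blast
qed

lemma primitive_set_primitive_words:
  assumes "primitive_words X ws" "set ws \<subseteq> carrier (free_group X)"
  shows "distinct ws" "primitive_set (free_group X) (set ws)"
proof -
  obtain \<sigma> xs where \<sigma>: "automorphism_words X \<sigma>" "distinct xs" "set xs \<subseteq> X"
      "list_all2 (\<lambda>w x. w \<sim> \<sigma> x) ws xs"
    using assms(1) unfolding primitive_words_def by blast
  have "ws = map (\<lambda>x. free_reduce (\<sigma> x)) xs"
  proof (rule nth_equalityI)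
    show "length ws = length (map (\<lambda>x. free_reduce (\<sigma> x)) xs)"
      using list_all2_lengthD[OF \<sigma>(4)] by simp
    fix i assume i: "i < length ws"
    then have "reduced (ws ! i)" using assms(2) nth_mem by (force simp: carrier_free_group)
    then have "ws ! i = free_reduce (ws ! i)" by (simp add: free_reduce_id)
    also have "\<dots> = free_reduce (\<sigma> (xs ! i))"
      using \<sigma>(4) i by (simp add: list_all2_conv_all_nth)
    finally show "ws ! i = map (\<lambda>x. free_reduce (\<sigma> x)) xs ! i"
      using list_all2_lengthD[OF \<sigma>(4)] i by simp
  qed
  then show "distinct ws" "primitive_set (free_group X) (set ws)"
    using \<sigma>(2,3) free_basis_automorphism[OF \<sigma>(1)] inj_on_subset[OF automorphism_words_inj[OF \<sigma>(1)]]
    unfolding primitive_set_def by (auto simp: distinct_map)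
qed

text \<open>
  Each sweep can be undone by an automorphism, so primitivity is inherited backwards from
  the final tape, on which it is evident.
\<close>

lemma sweeps_sound:
  assumes "(collapse_relation X)\<^sup>*\<^sup>* t t'" "contents t' \<in> standard_strings X n" "n > 0"
  shows "primitive_words X (words (contents t)) \<and> length (words (contents t)) = n"
  using assms(1)
proof (induction rule: converse_rtranclp_induct)
  case base
  obtain as where as: "contents t' = hash_join (map (\<lambda>a. [a]) as)" "length as = n"
      "distinct (map fst as)" "set as \<subseteq> X \<times> UNIV"
    using assms(2) unfolding standard_strings_def by blast
  then have "words (contents t') = map (\<lambda>a. [a]) as"
    using assms(3) by auto
  then show ?case using primitive_words_letters[OF as(3,4)] as(2) by simp
next
  case (step t t1)
  then obtain \<beta> S T where \<beta>: "\<beta> \<in> X \<times> UNIV" "run (tape_delta \<beta> S T) False t t1 False"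
    unfolding collapse_relation_def by blast
  have collapse: "list_all2 (\<lambda>w w'. collapse_word \<beta> S T False w w' False)
      (words (contents t)) (words (contents t1))"
    using run_collapse_words[OF \<beta>(2)] by (simp add: collapse_words_False)
  then have "list_all2 (\<lambda>w w'. w \<sim> lift (whitehead \<beta> S T) w')
      (words (contents t)) (words (contents t1))"
    by (rule list_all2_mono) (rule free_eq_lift_whitehead)
  then show ?case
    using primitive_words_automorphism[OF _ automorphism_whitehead[OF \<beta>(1)]] step.IH
      list_all2_lengthD[OF collapse] by metis
qed

text \<open>
  Every generator has to occur in the family. With at most one letter for each of at most
  \<open>card X\<close> words, this leaves no room for repetitions or empty words.
\<close>

lemma short_generating_letters:
  assumes "generating X (set bs)" "length bs \<le> card X"
    and "\<And>b. b \<in> set bs \<Longrightarrow> length b \<le> 1"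
  shows "bs = map (\<lambda>a. [a]) (concat bs) \<and> distinct (map fst (concat bs))"
proof -
  have "X \<subseteq> set (map fst (concat bs))"
    using generating_letters[OF assms(1)] by fastforce
  then have card: "card X \<le> card (set (map fst (concat bs)))"
    by (intro card_mono) auto
  have card': "card (set (map fst (concat bs))) \<le> length (concat bs)"
    using card_length[of "map fst (concat bs)"] by simp
  have len: "length (concat cs) \<le> length cs" if "\<forall>b \<in> set cs. length b \<le> 1" for cs :: "'a word list"
    using that by (induction cs) auto
  have "length (concat cs) = length cs \<Longrightarrow> cs = map (\<lambda>a. [a]) (concat cs)"
    if "\<forall>b \<in> set cs. length b \<le> 1" for cs :: "'a word list"
    using that
  proof (induction cs)
    case (Cons b cs)
    then show ?case using len[of cs] by (cases b) auto
  qed simp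
  moreover have "length (concat bs) = length bs"
    using card card' assms(2,3) len[of bs] by simp
  moreover have "card (set (map fst (concat bs))) = length (map fst (concat bs))"
    using card card' assms(2,3) len[of bs] by simp
  then have "distinct (map fst (concat bs))" by (rule card_distinct)
  ultimately show ?thesis using assms(3) by blast
qed

text \<open>
  The tape holds the first words of a generating family; the other words only guide the
  choice of the collapses.
\<close>

lemma sweeps_complete:
  assumes "finite X" "set (ws @ vs) \<subseteq> lists (X \<times> UNIV)" "generating X (set (ws @ vs))"
    and "length (ws @ vs) \<le> card X"
    and "t \<in> lists (cells (hash_alphabet X))" "words (contents t) = ws"
  shows "\<exists>t'. (collapse_relation X)\<^sup>*\<^sup>* t t' \<and> t' \<in> lists (cells (hash_alphabet X)) \<and>
    contents t' \<in> standard_strings X (length ws)"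
  using assms(2-)
proof (induction "length (concat (ws @ vs))" arbitrary: ws vs t rule: less_induct)
  case less
  let ?bs = "ws @ vs"
  show ?case
  proof (cases "\<exists>b \<in> set ?bs. length b \<ge> 2")
    case False
    then have "length b \<le> 1" if "b \<in> set ?bs" for b
      using that by (force simp: not_le less_Suc_eq_le numeral_2_eq_2)
    from short_generating_letters[OF less.prems(2,3) this]
    obtain cs where cs: "?bs = map (\<lambda>a. [a]) cs" "distinct (map fst cs)"
      by blast
    define as where "as = take (length ws) cs"
    have "ws = take (length ws) ?bs" by simp
    also have "\<dots> = map (\<lambda>a. [a]) as" unfolding cs(1) as_def take_map ..
    finally have ws: "ws = map (\<lambda>a. [a]) as" .
    have "distinct (map fst as)"
      unfolding as_def take_map[symmetric] using cs(2) by (rule distinct_take)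
    moreover have "set as \<subseteq> X \<times> UNIV"
    proof
      fix a assume "a \<in> set as"
      then have "[a] \<in> set (ws @ vs)" unfolding ws by simp
      then have "[a] \<in> lists (X \<times> UNIV)" using less.prems(1) by (rule subsetD[rotated])
      then show "a \<in> X \<times> UNIV" by simp
    qed
    moreover have "contents t = hash_join (map (\<lambda>a. [a]) as)"
      using hash_join_words[of "contents t"] unfolding less.prems(5) ws ..
    moreover have "length as = length ws" unfolding ws by simp
    ultimately have "contents t \<in> standard_strings X (length ws)"
      unfolding standard_strings_def by blast
    then show ?thesis using less.prems(4) by blast
  next
    case True
    obtain \<beta> S T bs' where \<beta>: "\<beta> \<in> X \<times> UNIV" "S \<subseteq> X" "T \<subseteq> X"
        and collapse: "list_all2 (\<lambda>b b'. collapse_word \<beta> S T False b b' False) ?bs bs'"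
        and shorter: "length (concat bs') < length (concat ?bs)"
      using generating_collapse[OF assms(1) less.prems(1-3) True] by blast
    obtain ws' vs' where bs': "bs' = ws' @ vs'"
        "list_all2 (\<lambda>b b'. collapse_word \<beta> S T False b b' False) ws ws'"
      using collapse unfolding list_all2_append1 by blast
    have lists': "set bs' \<subseteq> lists (X \<times> UNIV)"
    proof
      fix b' assume "b' \<in> set bs'"
      then obtain b where "b \<in> set ?bs" "collapse_word \<beta> S T False b b' False"
        using collapse unfolding list_all2_conv_all_nth by (metis in_set_conv_nth)
      then show "b' \<in> lists (X \<times> UNIV)"
        using collapse_word_subset less.prems(1) unfolding lists_eq_set by blast
    qed
    have "list_all2 (\<lambda>b b'. b \<sim> lift (whitehead \<beta> S T) b') ?bs bs'"
      using collapse by (rule list_all2_mono) (rule free_eq_lift_whitehead)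
    then have gen': "generating X (set bs')"
      using less.prems(2) automorphism_whitehead[OF \<beta>(1)] lists' generating_automorphism by blast
    have "ws \<noteq> []" using less.prems(5) by auto
    then have "collapse_words \<beta> S T False (words (contents t)) ws'"
      using bs'(2) less.prems(5) by (simp add: collapse_words_False)
    from collapse_words_run[OF this]
    obtain t1 where t1: "run (tape_delta \<beta> S T) False t t1 False" "words (contents t1) = ws'"
      by blast
    have step: "collapse_relation X t t1"
      unfolding collapse_relation_def
      by (intro conjI exI[of _ \<beta>] exI[of _ S] exI[of _ T]) (fact less.prems(4) \<beta> t1(1))+
    have t1_lists: "t1 \<in> lists (cells (hash_alphabet X))"
      using run_tape_delta_in_lists[OF t1(1) less.prems(4)] .
    have "\<exists>t'. (collapse_relation X)\<^sup>*\<^sup>* t1 t' \<and> t' \<in> lists (cells (hash_alphabet X)) \<and>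
        contents t' \<in> standard_strings X (length ws')"
    proof (rule less.hyps)
      show "length (ws' @ vs') \<le> card X"
        using less.prems(3) list_all2_lengthD[OF collapse] bs'(1) by simp
    qed (use shorter lists' gen' t1_lists t1(2) bs'(1) in auto)
    then show ?thesis
      using step list_all2_lengthD[OF bs'(2)] by (metis converse_rtranclp_into_rtranclp)
  qed
qed

lemma primitive_set_language_iff:
  assumes "finite X" "n > 0" "s \<in> lists (hash_alphabet X)"
  shows "s \<in> primitive_set_language X n \<longleftrightarrow>
    (\<forall>w \<in> set (words s). reduced w) \<and>
    (\<exists>t. (collapse_relation X)\<^sup>*\<^sup>* (map Some s) t \<and> t \<in> lists (cells (hash_alphabet X)) \<and>
      contents t \<in> standard_strings X n)"
    (is "?L \<longleftrightarrow> ?R")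
proof
  assume ?L
  then obtain ws where ws: "s = hash_join ws" "length ws = n" "distinct ws"
      "set ws \<subseteq> carrier (free_group X)" "primitive_set (free_group X) (set ws)"
    unfolding primitive_set_language_def by blast
  then have words: "words s = ws" using assms(2) by auto
  obtain B where B: "free_basis (free_group X) B" "set ws \<subseteq> B"
    using ws(5) unfolding primitive_set_def by blast
  note rank = card_free_basis[OF assms(1) B(1)]
  obtain vs where vs: "set vs = B - set ws" "distinct vs"
    using finite_distinct_list[of "B - set ws"] rank(1) by auto
  have set: "set (ws @ vs) = B" using vs(1) B(2) by auto
  have "length (ws @ vs) = card B"
    using distinct_card[of "ws @ vs"] set vs ws(3) by auto
  then have len: "length (ws @ vs) \<le> card X" using rank(2) by simp
  have lists: "set (ws @ vs) \<subseteq> lists (X \<times> UNIV)"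
    unfolding set using B(1) carrier_free_group unfolding free_basis_def by blast
  have gen: "generating X (set (ws @ vs))"
    unfolding set using B(1) by (rule generating_free_basis)
  have "map Some s \<in> lists (cells (hash_alphabet X))"
    using assms(3) by (auto simp: cells_def)
  then have "\<exists>t. (collapse_relation X)\<^sup>*\<^sup>* (map Some s) t \<and> t \<in> lists (cells (hash_alphabet X)) \<and>
      contents t \<in> standard_strings X (length ws)"
    using words by (intro sweeps_complete[OF assms(1) lists gen len]) simp_all
  moreover have "\<forall>w \<in> set (words s). reduced w"
    using ws(4) words carrier_free_group by blast
  ultimately show ?R using ws(2) by simp
next
  assume R: ?R
  then have prim: "primitive_words X (words s)" "length (words s) = n"
    using sweeps_sound[of X "map Some s" _ n] assms(2) by auto
  have "set (words s) \<subseteq> carrier (free_group X)"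
    using R words_in_lists[OF assms(3)] carrier_free_group by blast
  then show ?L
    using primitive_set_primitive_words[OF prim(1)] prim(2)
    unfolding primitive_set_language_def by (intro CollectI exI[of _ "words s"]) simp
qed

lemma primitive_set_language_subset:
  "primitive_set_language X n \<subseteq> lists (hash_alphabet X)"
proof
  fix s assume "s \<in> primitive_set_language X n"
  then obtain ws where "s = hash_join ws" "set ws \<subseteq> carrier (free_group X)"
    unfolding primitive_set_language_def by blast
  moreover from this have "set ws \<subseteq> lists (X \<times> UNIV)" using carrier_free_group by blast
  ultimately show "s \<in> lists (hash_alphabet X)" using hash_join_in_lists by blast
qed

lemma primitive_set_language_0: "primitive_set_language X 0 = {[]}"
proof -
  have "automorphism_words X (\<lambda>x. [(x, True)])"
    unfolding automorphism_words_def by (auto intro!: exI[of _ "\<lambda>x. [(x, True)]"])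
  then have "primitive_set (free_group X) {}"
    using free_basis_automorphism unfolding primitive_set_def by blast
  then show ?thesis by (auto simp: primitive_set_language_def)
qed

theorem context_sensitive_primitive_set_language:
  assumes "finite X"
  shows "context_sensitive (hash_alphabet X) (primitive_set_language X n)"
proof -
  let ?\<Sigma> = "hash_alphabet X"
  have \<Sigma>: "finite ?\<Sigma>" using assms by (rule finite_hash_alphabet)
  define accept where "accept D = (\<lambda>t t'. t' = t \<and> t \<in> lists (cells ?\<Sigma>) \<and> contents t \<in> D)"
    for D :: "'a symbol list set"
  have fin_accept: "finite_state_relation ?\<Sigma> (accept D)" if "finite D" "D \<subseteq> lists ?\<Sigma>" for D
    unfolding accept_def using \<Sigma> that by (rule finite_language_relation)
  show ?thesis
  proof (cases "n = 0")
    case True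
    \<comment> \<open>The language is \<open>{[]}\<close>. A tape without words would be decoded as one empty word,
      so all three sweeps just check that the tape is empty.\<close>
    let ?R = "accept {[]}"
    have R: "finite_state_relation ?\<Sigma> ?R" by (rule fin_accept) simp_all
    have star: "?R\<^sup>*\<^sup>* t t' \<Longrightarrow> t' = t" for t t'
      by (induction rule: rtranclp_induct) (auto simp: accept_def)
    have "{w \<in> lists ?\<Sigma>. \<exists>t0 t1 t2. ?R (map Some w) t0 \<and> ?R\<^sup>*\<^sup>* t0 t1 \<and> ?R t1 t2} = {[]}"
    proof (intro subset_antisym subsetI)
      fix w assume "w \<in> {w \<in> lists ?\<Sigma>. \<exists>t0 t1 t2. ?R (map Some w) t0 \<and> ?R\<^sup>*\<^sup>* t0 t1 \<and> ?R t1 t2}"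
      then show "w \<in> {[]}" by (auto simp: accept_def)
    next
      fix w :: "'a symbol list" assume "w \<in> {[]}"
      moreover have "?R [] []" by (simp add: accept_def)
      ultimately show "w \<in> {w \<in> lists ?\<Sigma>. \<exists>t0 t1 t2. ?R (map Some w) t0 \<and> ?R\<^sup>*\<^sup>* t0 t1 \<and> ?R t1 t2}"
        by auto
    qed
    then show ?thesis
      using context_sensitive_sweeps[OF \<Sigma> R R R] True primitive_set_language_0 by metis
  next
    case False
    then have n: "n > 0" by simp
    obtain R0 where R0: "finite_state_relation ?\<Sigma> R0"
        "\<And>s t. s \<in> lists ?\<Sigma> \<Longrightarrow>
          R0 (map Some s) t \<longleftrightarrow> t = map Some s \<and> (\<forall>w \<in> set (words s). reduced w)"
      using reduced_relation[OF \<Sigma>] by auto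
    let ?R2 = "accept (standard_strings X n)"
    have R2: "finite_state_relation ?\<Sigma> ?R2"
      using finite_standard_strings[OF assms] standard_strings_in_lists by (rule fin_accept)
    have "s \<in> primitive_set_language X n \<longleftrightarrow>
        (\<exists>t0 t1 t2. R0 (map Some s) t0 \<and> (collapse_relation X)\<^sup>*\<^sup>* t0 t1 \<and> ?R2 t1 t2)"
      if "s \<in> lists ?\<Sigma>" for s
      unfolding primitive_set_language_iff[OF assms n that] R0(2)[OF that] accept_def by blast
    then have "primitive_set_language X n = {s \<in> lists ?\<Sigma>.
        \<exists>t0 t1 t2. R0 (map Some s) t0 \<and> (collapse_relation X)\<^sup>*\<^sup>* t0 t1 \<and> ?R2 t1 t2}"
      using primitive_set_language_subset[of X n] by blast
    then show ?thesis
      using context_sensitive_sweeps[OF \<Sigma> R0(1) finite_state_collapse_relation[OF assms] R2] by simp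
  qed
qed

lemma primitive_element_language_eq: "primitive_element_language X = primitive_set_language X 1"
proof (intro subset_antisym subsetI)
  fix s assume "s \<in> primitive_element_language X"
  then obtain w where "s = map Letter w" "w \<in> carrier (free_group X)"
      "primitive_element (free_group X) w"
    unfolding primitive_element_language_def by blast
  then show "s \<in> primitive_set_language X 1"
    unfolding primitive_set_language_def primitive_set_def primitive_element_def
    by (intro CollectI exI[of _ "[w]"]) auto
next
  fix s assume "s \<in> primitive_set_language X 1"
  then obtain ws where ws: "s = hash_join ws" "length ws = 1" "set ws \<subseteq> carrier (free_group X)"
      "primitive_set (free_group X) (set ws)"
    unfolding primitive_set_language_def by blast
  then obtain w where "ws = [w]" by (auto simp: length_Suc_conv)
  with ws show "s \<in> primitive_element_language X"
    unfolding primitive_element_language_def primitive_set_def primitive_element_def by auto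
qed

theorem corollary15:
  fixes X :: "'a set" and k n :: nat
  assumes "finite X" and "card X = k" and "n \<le> k"
  shows "context_sensitive (hash_alphabet X) (primitive_set_language X n) \<and>
    primitive_element_language X = primitive_set_language X 1 \<and>
    context_sensitive (hash_alphabet X) (primitive_element_language X)"
  unfolding primitive_element_language_eq
  using context_sensitive_primitive_set_language[OF assms(1)] by blast

end
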